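(* Let $|\psi\rangle$ be a truly tripartite entangled pure state of three qubits. Then $|\psi\rangle$ belongs to CLU if and only if there exists a decomposition of $|\psi\rangle$ of the form $(\dagger)$ such that either $E(\psi_s)=\mathfrak{E}(C_{23})$ or $E(\psi_s)=\mathfrak{E}(C_{23}^a)$.
   Context: A pure three-qubit state is truly tripartite entangled if it is not a product state with respect to any of the bipartitions $1|23$, $2|13$, $3|12$. Two three-qubit states are LU-equivalent if they are related by $V_1\otimes V_2\otimes V_3$ with $V_i\in U(2)$. CLU is the class of states $|\psi\rangle$ that are LU-equivalent to their complex conjugate $|\psi^*\rangle$ (taken in the computational basis). A decomposition of $|\psi\rangle$ of the form $(\dagger)$ means that $|\psi\rangle$ is LU-equivalent to $$\tfrac1{\sqrt2}\big(|0\rangle_1|\psi_s\rangle_{23}+|1\rangle_1 (U_2\otimes U_3)|\psi_s\rangle_{23}\big),\qquad(\dagger)$$ where $|\psi_s\rangle=a|00\rangle+b|11\rangle$, $a\ge b\ge0$, $a^2+b^2=1$, $U_2=Z(\alpha)Y(\beta)Z(\gamma)$, $U_3=Y(\beta')$, $\alpha,\gamma\in(-\pi/2,\pi/2]$, $\beta,\beta'\in[0,\pi/2]$, $Y(\xi)=e^{i\xi\sigma_y}$, $Z(\xi)=e^{i\xi\sigma_z}$, with $\sigma_{x,y,z}$ the Pauli matrices. (Every truly tripartite entangled state has such a decomposition, and always $\mathfrak{E}(C_{23})\le E(\psi_s)\le\mathfrak{E}(C_{23}^a)$.) $E$ of a two-qubit pure state is the von Neumann entropy (base-2 logarithm) of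 a one-qubit reduced state. The concurrence of a two-qubit pure state is $C(\phi)=|\langle\tilde\phi|\phi\rangle|$, $|\tilde\phi\rangle=\sigma_y\otimes\sigma_y|\phi^*\rangle$, and $E(\phi)=\mathfrak{E}(C(\phi))$ with the strictly increasing function $\mathfrak{E}(C)=h\big(\tfrac{1+\sqrt{1-C^2}}2\big)$, $h(x)=-x\log_2x-(1-x)\log_2(1-x)$. For the reduced state $\rho_{23}$ of $|\psi\rangle$ on qubits $2,3$, $C_{23}=\min\sum_j\pi_jC(\phi_j)$ and $C_{23}^a=\max\sum_j\pi_jC(\phi_j)$ over all pure-state ensembles $\rho_{23}=\sum_j\pi_j|\phi_j\rangle\langle\phi_j|$. *)

theory Defs
  imports "HOL-Analysis.Analysis" "HOL-Computational_Algebra.Polynomial"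
begin

definition cnj_vec :: "complex^'n \<Rightarrow> complex^'n" where
  "cnj_vec v = (\<chi> i. cnj (v $ i))"

definition cinner :: "complex^'n \<Rightarrow> complex^'n \<Rightarrow> complex" where
  "cinner v w = (\<Sum>i\<in>UNIV. cnj (v $ i) * w $ i)"

definition dagger :: "complex^'n^'m \<Rightarrow> complex^'m^'n" where
  "dagger A = map_matrix cnj (transpose A)"

definition unitary :: "complex^'n^'n \<Rightarrow> bool" where
  "unitary U \<longleftrightarrow> dagger U ** U = mat 1 \<and> U ** dagger U = mat 1"

definition tensor_vec :: "complex^'a \<Rightarrow> complex^'b \<Rightarrow> complex^('a \<times> 'b)"
    (infixr "\<otimes>\<^sub>v" 71) where
  "v \<otimes>\<^sub>v w = (\<chi> p. v $ fst p * w $ snd p)"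

definition tensor_mat :: "complex^'a^'c \<Rightarrow> complex^'b^'d \<Rightarrow> complex^('a \<times> 'b)^('c \<times> 'd)"
    (infixr "\<otimes>\<^sub>m" 71) where
  "A \<otimes>\<^sub>m B = (\<chi> p q. A $ fst p $ fst q * B $ snd p $ snd q)"

definition proj :: "complex^'n \<Rightarrow> complex^'n^'n" where
  "proj v = (\<chi> i j. v $ i * cnj (v $ j))"

definition ptrace_fst :: "complex^('a::finite \<times> 'b::finite)^('a \<times> 'b) \<Rightarrow> complex^'b^'b" where
  "ptrace_fst \<rho> = (\<chi> j l. \<Sum>i\<in>UNIV. \<rho> $ (i, j) $ (i, l))"

definition ptrace_snd :: "complex^('a::finite \<times> 'b::finite)^('a \<times> 'b) \<Rightarrow> complex^'a^'a" where
  "ptrace_snd \<rho> = (\<chi> i k. \<Sum>j\<in>UNIV. \<rho> $ (i, j) $ (k, j))"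

primrec mat_pow :: "complex^'n^'n \<Rightarrow> nat \<Rightarrow> complex^'n^'n" where
  "mat_pow A 0 = mat 1"
| "mat_pow A (Suc n) = A ** mat_pow A n"

definition mat_exp :: "complex^'n^'n \<Rightarrow> complex^'n^'n" where
  "mat_exp A = (\<Sum>n. (1 / fact n) *\<^sub>R mat_pow A n)"

definition charpoly :: "complex^'n^'n \<Rightarrow> complex poly" where
  "charpoly A = det (\<chi> i j. (if i = j then [:0, 1:] else 0) - [:A $ i $ j:])"

text \<open>The two elements of the index type \<open>2\<close> are \<open>0\<close> and \<open>1\<close>, which label the
  computational basis. A vector of \<open>qubits3\<close> has the components \<open>\<psi> $ (i, j, k)\<close>, where
  \<open>(i, j, k)\<close> stands for \<open>(i, (j, k))\<close>; thus the split \<open>1|23\<close> is built into the type.\<close>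

type_synonym qubit = "complex^2"
type_synonym qubits2 = "complex^(2 \<times> 2)"
type_synonym qubits3 = "complex^(2 \<times> 2 \<times> 2)"

definition ket :: "2 \<Rightarrow> qubit" where
  "ket i = axis i 1"

definition sigma_y :: "complex^2^2" where
  "sigma_y = (\<chi> i j. if i = j then 0 else if i = 0 then - \<i> else \<i>)"

definition sigma_z :: "complex^2^2" where
  "sigma_z = (\<chi> i j. if i \<noteq> j then 0 else if i = 0 then 1 else - 1)"

definition rotY :: "real \<Rightarrow> complex^2^2" where
  "rotY \<xi> = mat_exp (map_matrix (\<lambda>x. \<i> * of_real \<xi> * x) sigma_y)"

definition rotZ :: "real \<Rightarrow> complex^2^2" where
  "rotZ \<xi> = mat_exp (map_matrix (\<lambda>x. \<i> * of_real \<xi> * x) sigma_z)"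

definition is_state :: "complex^'n \<Rightarrow> bool" where
  "is_state v \<longleftrightarrow> norm v = 1"

definition truly_tripartite_entangled :: "qubits3 \<Rightarrow> bool" where
  "truly_tripartite_entangled \<psi> \<longleftrightarrow>
     \<not> (\<exists>(\<phi>::qubit) (\<eta>::qubits2). is_state \<phi> \<and> is_state \<eta> \<and>
          (\<forall>i j k. \<psi> $ (i, j, k) = \<phi> $ i * \<eta> $ (j, k))) \<and>
     \<not> (\<exists>(\<phi>::qubit) (\<eta>::qubits2). is_state \<phi> \<and> is_state \<eta> \<and>
          (\<forall>i j k. \<psi> $ (i, j, k) = \<phi> $ j * \<eta> $ (i, k))) \<and>
     \<not> (\<exists>(\<phi>::qubit) (\<eta>::qubits2). is_state \<phi> \<and> is_state \<eta> \<and>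
          (\<forall>i j k. \<psi> $ (i, j, k) = \<phi> $ k * \<eta> $ (i, j)))"

definition LU_equivalent :: "qubits3 \<Rightarrow> qubits3 \<Rightarrow> bool" where
  "LU_equivalent \<psi> \<phi> \<longleftrightarrow>
     (\<exists>V1 V2 V3. unitary V1 \<and> unitary V2 \<and> unitary V3 \<and>
        \<phi> = (V1 \<otimes>\<^sub>m V2 \<otimes>\<^sub>m V3) *v \<psi>)"

definition CLU :: "qubits3 set" where
  "CLU = {\<psi>. is_state \<psi> \<and> LU_equivalent \<psi> (cnj_vec \<psi>)}"

text \<open>\<open>- tr (\<rho> log\<^sub>2 \<rho>)\<close>, summed over the eigenvalues of \<open>\<rho>\<close> with multiplicity. The
  convention \<open>0 log 0 = 0\<close> holds whatever the value of \<open>log 2 0\<close>.\<close>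

definition vn_entropy :: "complex^'n^'n \<Rightarrow> real" where
  "vn_entropy \<rho> = - (\<Sum>x\<in>#proots (charpoly \<rho>). Re x * log 2 (Re x))"

definition entanglement :: "qubits2 \<Rightarrow> real" where
  "entanglement \<phi> = vn_entropy (ptrace_snd (proj \<phi>))"

definition concurrence :: "qubits2 \<Rightarrow> real" where
  "concurrence \<phi> = cmod (cinner ((sigma_y \<otimes>\<^sub>m sigma_y) *v cnj_vec \<phi>) \<phi>)"

definition binary_entropy :: "real \<Rightarrow> real" where
  "binary_entropy x = - x * log 2 x - (1 - x) * log 2 (1 - x)"

definition ent_of_concurrence :: "real \<Rightarrow> real" where
  "ent_of_concurrence C = binary_entropy ((1 + sqrt (1 - C\<^sup>2)) / 2)"

definition is_ensemble ::
    "complex^'n^'n \<Rightarrow> nat \<Rightarrow> (nat \<Rightarrow> real) \<Rightarrow> (nat \<Rightarrow> complex^'n) \<Rightarrow> bool" where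
  "is_ensemble \<rho> n p \<phi> \<longleftrightarrow>
     (\<forall>j<n. 0 \<le> p j \<and> is_state (\<phi> j)) \<and> (\<Sum>j<n. p j) = 1 \<and>
     \<rho> = (\<Sum>j<n. p j *\<^sub>R proj (\<phi> j))"

definition mean_concurrences :: "complex^(2 \<times> 2)^(2 \<times> 2) \<Rightarrow> real set" where
  "mean_concurrences \<rho> = {\<Sum>j<n. p j * concurrence (\<phi> j) | n p \<phi>. is_ensemble \<rho> n p \<phi>}"

text \<open>\<^const>\<open>Min\<close> and \<^const>\<open>Max\<close> are not usable here because the set of
  mean concurrences need not be finite. Both extrema are attained.\<close>

definition C23 :: "qubits3 \<Rightarrow> real" where
  "C23 \<psi> = (LEAST c. c \<in> mean_concurrences (ptrace_fst (proj \<psi>)))"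

definition C23a :: "qubits3 \<Rightarrow> real" where
  "C23a \<psi> = (GREATEST c. c \<in> mean_concurrences (ptrace_fst (proj \<psi>)))"

definition psi_s :: "real \<Rightarrow> real \<Rightarrow> qubits2" where
  "psi_s a b = a *\<^sub>R (ket 0 \<otimes>\<^sub>v ket 0) + b *\<^sub>R (ket 1 \<otimes>\<^sub>v ket 1)"

definition is_decomposition ::
    "qubits3 \<Rightarrow> real \<Rightarrow> real \<Rightarrow> real \<Rightarrow> real \<Rightarrow> real \<Rightarrow> real \<Rightarrow> bool" where
  "is_decomposition \<psi> a b \<alpha> \<beta> \<gamma> \<beta>' \<longleftrightarrow>
     a \<ge> b \<and> b \<ge> 0 \<and> a\<^sup>2 + b\<^sup>2 = 1 \<and>
     \<alpha> \<in> {- pi / 2<..pi / 2} \<and> \<gamma> \<in> {- pi / 2<..pi / 2} \<and>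
     \<beta> \<in> {0..pi / 2} \<and> \<beta>' \<in> {0..pi / 2} \<and>
     LU_equivalent \<psi>
       ((1 / sqrt 2) *\<^sub>R
         (ket 0 \<otimes>\<^sub>v psi_s a b +
          ket 1 \<otimes>\<^sub>v (((rotZ \<alpha> ** rotY \<beta> ** rotZ \<gamma>) \<otimes>\<^sub>m rotY \<beta>') *v psi_s a b)))"

end

theory Submission
  imports Defs
begin

text \<open>Write the state as two branches \<open>|0\<rangle>M + |1\<rangle>N\<close> with \<open>2 \<times> 2\<close> coefficient matrices, and let
  \<open>\<tau>\<close> be the symmetric bilinear form polarizing twice the determinant, so that \<open>|\<tau>(M, M)|\<close> is the
  concurrence. A local unitary acts on the matrix of \<open>\<tau>\<close> on the branches by congruence with a
  unitary, up to a phase; by Takagi's factorization it may be taken diagonal with entries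
  \<open>\<lambda>\<^sub>1 \<ge> \<lambda>\<^sub>2 \<ge> 0\<close>, and then the two extremal mean concurrences are \<open>\<lambda>\<^sub>1 \<mp> \<lambda>\<^sub>2\<close>.

  In a decomposition both branches have \<open>\<tau>\<close>-value \<open>ab\<close>, and \<open>2ab = \<lambda>\<^sub>1 \<mp> \<lambda>\<^sub>2\<close> forces \<open>ab = 0\<close> or their
  mutual \<open>\<tau>\<close>-value to be real; this means \<open>b = 0\<close>, \<open>a = b\<close>, \<open>sin \<beta> = 0\<close>, \<open>sin \<beta>' = 0\<close> or
  \<open>\<alpha> = \<gamma>\<close>, and in each case a local unitary conjugates the state. Conversely, if the state is
  equivalent to its conjugate, the Takagi branches can be chosen with an overlap that is real or
  imaginary. Then \<open>(M \<plusminus> \<i>N)/\<surd>2\<close> respectively \<open>(M \<plusminus> N)/\<surd>2\<close> have equal norms and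
  equal determinants, hence equal singular values, which gives an extremal decomposition.\<close>

section \<open>Explicit calculus of 2 x 2 complex matrices and of the forms \<open>pdet\<close> and
  \<open>frob\<close>\<close>

definition mat2 :: "complex \<Rightarrow> complex \<Rightarrow> complex \<Rightarrow> complex \<Rightarrow> complex^2^2" where
  "mat2 a b c d = (\<chi> i j. if i = 0 then (if j = 0 then a else b) else (if j = 0 then c else d))"

definition smul :: "complex \<Rightarrow> complex^2^2 \<Rightarrow> complex^2^2" where
  "smul c M = (\<chi> i j. c * M $ i $ j)"

definition cnj_mat :: "complex^2^2 \<Rightarrow> complex^2^2" where
  "cnj_mat M = map_matrix cnj M"

text \<open>The polarization of \<open>2 det\<close>.\<close>

definition pdet :: "complex^2^2 \<Rightarrow> complex^2^2 \<Rightarrow> complex" where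
  "pdet M N = M $ 0 $ 0 * N $ 1 $ 1 + M $ 1 $ 1 * N $ 0 $ 0 - M $ 0 $ 1 * N $ 1 $ 0 - M $ 1 $ 0 * N $ 0 $ 1"

text \<open>The Hilbert-Schmidt inner product, antilinear in the first argument; on coefficient
  matrices it is the inner product of the two-qubit vectors.\<close>

definition frob :: "complex^2^2 \<Rightarrow> complex^2^2 \<Rightarrow> complex" where
  "frob M N = cnj (M $ 0 $ 0) * N $ 0 $ 0 + cnj (M $ 0 $ 1) * N $ 0 $ 1
     + cnj (M $ 1 $ 0) * N $ 1 $ 0 + cnj (M $ 1 $ 1) * N $ 1 $ 1"

text \<open>\<open>forall_2\<close>, \<open>UNIV_2\<close> and \<open>det_2\<close> label the
  indices 1 and 2. This rewrites them to the basis labels 0 and 1.\<close>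

lemma two_eq_zero: "(2::2) = 0"
  by simp

lemma forall_2': "(\<forall>i::2. P i) \<longleftrightarrow> P 0 \<and> P 1"
  using forall_2[of P] unfolding two_eq_zero by auto

lemma neq_zero_iff_2: "(i::2) \<noteq> 0 \<longleftrightarrow> i = 1"
  using forall_2'[of "\<lambda>i. i \<noteq> 0 \<longleftrightarrow> i = 1"] by simp

lemma sum_2': "(\<Sum>i\<in>(UNIV::2 set). f i) = f 0 + f 1"
  unfolding UNIV_2 two_eq_zero by (simp add: add.commute)

lemma sum_UNIV_prod:
  "(\<Sum>p\<in>(UNIV::('a::finite \<times> 'b::finite) set). f p) = (\<Sum>a\<in>UNIV. \<Sum>b\<in>UNIV. f (a, b))"
  by (simp add: sum.cartesian_product flip: UNIV_Times_UNIV)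

lemma mat2_nth [simp]:
  "mat2 a b c d $ 0 $ 0 = a" "mat2 a b c d $ 0 $ 1 = b"
  "mat2 a b c d $ 1 $ 0 = c" "mat2 a b c d $ 1 $ 1 = d"
  by (simp_all add: mat2_def)

lemma mat_eq_iff_2:
  "M = N \<longleftrightarrow> M $ 0 $ 0 = N $ 0 $ 0 \<and> M $ 0 $ 1 = N $ 0 $ 1 \<and> M $ 1 $ 0 = N $ 1 $ 0 \<and> M $ 1 $ 1 = N $ 1 $ 1"
  for M N :: "complex^2^2"
  by (auto simp: vec_eq_iff forall_2')

lemma mat2_cases:
  obtains a b c d where "M = mat2 a b c d"
  by (metis mat_eq_iff_2 mat2_nth)

lemma mat2_eq_iff [simp]: "mat2 a b c d = mat2 a' b' c' d' \<longleftrightarrow> a = a' \<and> b = b' \<and> c = c' \<and> d = d'"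
  by (simp add: mat_eq_iff_2)

lemma mat2_mult [simp]:
  "mat2 a b c d ** mat2 a' b' c' d' = mat2 (a*a' + b*c') (a*b' + b*d') (c*a' + d*c') (c*b' + d*d')"
  by (simp add: mat_eq_iff_2 matrix_matrix_mult_def sum_2')

lemma mat2_add [simp]: "mat2 a b c d + mat2 a' b' c' d' = mat2 (a+a') (b+b') (c+c') (d+d')"
  by (simp add: mat_eq_iff_2)

lemma smul_mat2 [simp]: "smul k (mat2 a b c d) = mat2 (k*a) (k*b) (k*c) (k*d)"
  by (simp add: mat_eq_iff_2 smul_def)

lemma transpose_mat2 [simp]: "transpose (mat2 a b c d) = mat2 a c b d"
  by (simp add: mat_eq_iff_2 transpose_def)

lemma cnj_mat_mat2 [simp]: "cnj_mat (mat2 a b c d) = mat2 (cnj a) (cnj b) (cnj c) (cnj d)"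
  by (simp add: mat_eq_iff_2 cnj_mat_def map_matrix_def)

lemma dagger_mat2 [simp]: "dagger (mat2 a b c d) = mat2 (cnj a) (cnj c) (cnj b) (cnj d)"
  by (simp add: mat_eq_iff_2 dagger_def map_matrix_def transpose_def)

lemma det_mat2 [simp]: "det (mat2 a b c d) = a * d - b * c"
  unfolding det_2 two_eq_zero by (simp add: mult.commute)

lemma mat_1_mat2: "mat 1 = mat2 1 0 0 1"
  by (simp add: mat_eq_iff_2 mat_def)

lemma pdet_mat2 [simp]: "pdet (mat2 a b c d) (mat2 a' b' c' d') = a * d' + d * a' - b * c' - c * b'"
  by (simp add: pdet_def)

lemma frob_mat2 [simp]:
  "frob (mat2 a b c d) (mat2 a' b' c' d') = cnj a * a' + cnj b * b' + cnj c * c' + cnj d * d'"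
  by (simp add: frob_def)

lemma unitaryI: "dagger U ** U = mat 1 \<Longrightarrow> unitary U"
  unfolding unitary_def using matrix_left_right_inverse by blast

lemma unitary_mat2_iff:
  "unitary (mat2 a b c d) \<longleftrightarrow>
    cnj a * a + cnj c * c = 1 \<and> cnj b * b + cnj d * d = 1 \<and> cnj a * b + cnj c * d = 0"
proof -
  have "unitary (mat2 a b c d) \<longleftrightarrow> dagger (mat2 a b c d) ** mat2 a b c d = mat 1"
    using unitaryI unitary_def by blast
  also have "\<dots> \<longleftrightarrow> cnj a * a + cnj c * c = 1 \<and> cnj b * b + cnj d * d = 1 \<and> cnj a * b + cnj c * d = 0
     \<and> cnj b * a + cnj d * c = 0"
    by (auto simp: mat_1_mat2)
  also have "cnj b * a + cnj d * c = cnj (cnj a * b + cnj c * d)"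
    by simp
  finally show ?thesis by (metis complex_cnj_zero)
qed

lemma dagger_dagger [simp]: "dagger (dagger U) = U"
  by (simp add: dagger_def transpose_def map_matrix_def vec_eq_iff)

lemma dagger_mult: "dagger (A ** B) = dagger B ** dagger A"
  by (simp add: dagger_def transpose_def map_matrix_def vec_eq_iff matrix_matrix_mult_def mult.commute)

lemma unitary_dagger: "unitary U \<Longrightarrow> unitary (dagger U)"
  by (simp add: unitary_def)

lemma unitary_mult: "unitary U \<Longrightarrow> unitary V \<Longrightarrow> unitary (U ** V)"
  unfolding unitary_def dagger_mult
  by (metis matrix_mul_assoc matrix_mul_rid)

lemma unitary_1: "unitary (mat 1 :: complex^'n^'n)"
proof -
  have "dagger (mat 1 :: complex^'n^'n) = mat 1"
    by (simp add: dagger_def transpose_def map_matrix_def vec_eq_iff mat_def)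
  then show ?thesis by (simp add: unitary_def)
qed

text \<open>The other half of unitarity, \<open>U ** dagger U = mat 1\<close>, says that the rows
  are orthonormal.\<close>

lemma unitary_transpose: "unitary U \<Longrightarrow> unitary (transpose U)" for U :: "complex^2^2"
proof -
  assume u: "unitary U"
  obtain a b c d where U: "U = mat2 a b c d" by (rule mat2_cases)
  from u have "U ** dagger U = mat 1" by (simp add: unitary_def)
  then have *: "a * cnj a + b * cnj b = 1" "c * cnj c + d * cnj d = 1" "c * cnj a + d * cnj b = 0"
    by (auto simp: U mat_1_mat2)
  then show ?thesis
    by (simp add: U unitary_mat2_iff mult.commute)
qed

lemma unitary_cnj_mat: "unitary U \<Longrightarrow> unitary (cnj_mat U)"
proof -
  assume "unitary U"
  then have "unitary (transpose (dagger U))"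
    by (intro unitary_transpose unitary_dagger)
  also have "transpose (dagger U) = cnj_mat U"
    by (simp add: cnj_mat_def dagger_def transpose_def map_matrix_def vec_eq_iff)
  finally show ?thesis .
qed

lemma unitary_det: "unitary U \<Longrightarrow> det U * cnj (det U) = 1" for U :: "complex^2^2"
proof -
  assume "unitary U"
  then have "det (dagger U) * det U = 1"
    unfolding unitary_def by (metis det_I det_mul)
  moreover have "det (dagger U) = cnj (det U)"
    by (rule mat2_cases[of U]) simp
  ultimately show ?thesis by (simp add: mult.commute)
qed

text \<open>Polarized multiplicativity of the determinant. Unitaries on qubits 2 and 3 therefore
  change \<tau> by one common phase.\<close>

lemma pdet_two_sided: "pdet (A ** M ** B) (A ** N ** B) = det A * det B * pdet M N"
proof -
  obtain a b c d where A: "A = mat2 a b c d" by (rule mat2_cases)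
  obtain a1 b1 c1 d1 where B: "B = mat2 a1 b1 c1 d1" by (rule mat2_cases)
  obtain a2 b2 c2 d2 where M: "M = mat2 a2 b2 c2 d2" by (rule mat2_cases)
  obtain a3 b3 c3 d3 where N: "N = mat2 a3 b3 c3 d3" by (rule mat2_cases)
  show ?thesis unfolding A B M N by (simp add: algebra_simps)
qed

lemma frob_left: "unitary A \<Longrightarrow> frob (A ** M) (A ** N) = frob M N"
proof -
  assume u: "unitary A"
  obtain a b c d where A: "A = mat2 a b c d" by (rule mat2_cases)
  obtain a2 b2 c2 d2 where M: "M = mat2 a2 b2 c2 d2" by (rule mat2_cases)
  obtain a3 b3 c3 d3 where N: "N = mat2 a3 b3 c3 d3" by (rule mat2_cases)
  have u1: "cnj a * a + cnj c * c = 1" "cnj b * b + cnj d * d = 1" "cnj a * b + cnj c * d = 0"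
    using u by (auto simp: A unitary_mat2_iff)
  have u2: "cnj b * a + cnj d * c = 0" using arg_cong[OF u1(3), of cnj] by (simp add: mult.commute)
  \<comment> \<open>The last factors of the four products are the entries of
    \<open>dagger A ** A\<close>.\<close>
  have "frob (A ** M) (A ** N) = (cnj a2 * a3 + cnj b2 * b3) * (cnj a * a + cnj c * c)
     + (cnj c2 * c3 + cnj d2 * d3) * (cnj b * b + cnj d * d)
     + (cnj a2 * c3 + cnj b2 * d3) * (cnj a * b + cnj c * d)
     + (cnj c2 * a3 + cnj d2 * b3) * (cnj b * a + cnj d * c)"
    unfolding A M N by (simp add: algebra_simps)
  then show ?thesis unfolding u1 u2 by (simp add: M N)
qed

lemma frob_transpose: "frob (transpose M) (transpose N) = frob M N"
  by (rule mat2_cases[of M], rule mat2_cases[of N]) simp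

lemma frob_two_sided: "unitary A \<Longrightarrow> unitary B \<Longrightarrow> frob (A ** M ** B) (A ** N ** B) = frob M N"
  by (metis frob_left frob_transpose matrix_transpose_mul unitary_transpose)

lemma pdet_comm: "pdet M N = pdet N M"
  by (simp add: pdet_def)

lemma frob_comm: "frob M N = cnj (frob N M)"
  by (simp add: frob_def mult.commute)

lemma pdet_lin:
  "pdet (smul a M + smul b N) K = a * pdet M K + b * pdet N K"
  "pdet K (smul a M + smul b N) = a * pdet K M + b * pdet K N"
  by (simp_all add: pdet_def smul_def algebra_simps)

lemma frob_lin:
  "frob (smul a M + smul b N) K = cnj a * frob M K + cnj b * frob N K"
  "frob K (smul a M + smul b N) = a * frob K M + b * frob K N"
  by (simp_all add: frob_def smul_def algebra_simps)

lemma cnj_mat_pdet: "pdet (cnj_mat M) (cnj_mat N) = cnj (pdet M N)"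
  by (simp add: pdet_def cnj_mat_def map_matrix_def)

lemma cnj_mat_frob: "frob (cnj_mat M) (cnj_mat N) = cnj (frob M N)"
  by (simp add: frob_def cnj_mat_def map_matrix_def)

lemma frob_self: "frob M M = of_real (\<Sum>i\<in>UNIV. \<Sum>j\<in>UNIV. (cmod (M $ i $ j))\<^sup>2)"
  by (simp add: frob_def sum_2' complex_norm_square[symmetric] mult.commute del: of_real_power)

subsection \<open>Local unitary equivalence on the branches of the first qubit\<close>

definition of_branches :: "complex^2^2 \<Rightarrow> complex^2^2 \<Rightarrow> qubits3" where
  "of_branches M N = (\<chi> p. (if fst p = 0 then M else N) $ fst (snd p) $ snd (snd p))"

definition branch :: "qubits3 \<Rightarrow> 2 \<Rightarrow> complex^2^2" where
  "branch \<psi> i = (\<chi> j k. \<psi> $ (i, j, k))"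

lemma branch_of_branches [simp]:
  "branch (of_branches M N) 0 = M" "branch (of_branches M N) 1 = N"
  by (simp_all add: branch_def of_branches_def vec_eq_iff)

lemma of_branches_branch: "of_branches (branch \<psi> 0) (branch \<psi> 1) = \<psi>"
  using forall_2'[of "\<lambda>i. \<forall>j k. of_branches (branch \<psi> 0) (branch \<psi> 1) $ (i,j,k) = \<psi> $ (i,j,k)"]
  by (auto simp: branch_def of_branches_def vec_eq_iff)

lemma cnj_vec_of_branches: "cnj_vec (of_branches M N) = of_branches (cnj_mat M) (cnj_mat N)"
  by (simp add: cnj_vec_def of_branches_def vec_eq_iff cnj_mat_def map_matrix_def)

text \<open>Rows belong to qubit 2 and columns to qubit 3, so \<open>V3\<close> acts from the right
  through its transpose, while \<open>V1\<close> forms linear combinations of the branches.\<close>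

lemma tensor_mat_of_branches:
  "(V1 \<otimes>\<^sub>m V2 \<otimes>\<^sub>m V3) *v of_branches M N =
    of_branches (smul (V1 $ 0 $ 0) (V2 ** M ** transpose V3) + smul (V1 $ 0 $ 1) (V2 ** N ** transpose V3))
      (smul (V1 $ 1 $ 0) (V2 ** M ** transpose V3) + smul (V1 $ 1 $ 1) (V2 ** N ** transpose V3))"
proof -
  have "((V1 \<otimes>\<^sub>m V2 \<otimes>\<^sub>m V3) *v of_branches M N) $ (i, j, k) =
     V1 $ i $ 0 * (V2 ** M ** transpose V3) $ j $ k + V1 $ i $ 1 * (V2 ** N ** transpose V3) $ j $ k" for i j k
    by (simp add: matrix_vector_mult_def sum_UNIV_prod sum_2' tensor_mat_def of_branches_def
      matrix_matrix_mult_def transpose_def algebra_simps)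
  then show ?thesis
    by (auto simp: vec_eq_iff of_branches_def smul_def neq_zero_iff_2)
qed

lemma tensor_mat_mult: "(A \<otimes>\<^sub>m B) ** (C \<otimes>\<^sub>m D) = (A ** C) \<otimes>\<^sub>m (B ** D)"
  by (simp add: vec_eq_iff matrix_matrix_mult_def tensor_mat_def sum_UNIV_prod sum_product mult.assoc mult.left_commute)

lemma tensor_mat_1: "mat 1 \<otimes>\<^sub>m mat 1 = mat 1"
  by (auto simp: vec_eq_iff tensor_mat_def mat_def)

lemma LU_trans: "LU_equivalent \<psi> \<phi> \<Longrightarrow> LU_equivalent \<phi> \<xi> \<Longrightarrow> LU_equivalent \<psi> \<xi>"
  unfolding LU_equivalent_def
proof (elim exE conjE)
  fix V1 V2 V3 W1 W2 W3
  assume "unitary V1" "unitary V2" "unitary V3" "unitary W1" "unitary W2" "unitary W3"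
    and "\<phi> = (V1 \<otimes>\<^sub>m V2 \<otimes>\<^sub>m V3) *v \<psi>" "\<xi> = (W1 \<otimes>\<^sub>m W2 \<otimes>\<^sub>m W3) *v \<phi>"
  then show "\<exists>V1 V2 V3. unitary V1 \<and> unitary V2 \<and> unitary V3 \<and> \<xi> = (V1 \<otimes>\<^sub>m V2 \<otimes>\<^sub>m V3) *v \<psi>"
    by (intro exI[of _ "W1 ** V1"] exI[of _ "W2 ** V2"] exI[of _ "W3 ** V3"])
       (simp add: unitary_mult tensor_mat_mult matrix_vector_mul_assoc)
qed

lemma LU_sym: "LU_equivalent \<psi> \<phi> \<Longrightarrow> LU_equivalent \<phi> \<psi>"
  unfolding LU_equivalent_def
proof (elim exE conjE)
  fix V1 V2 V3 assume u: "unitary V1" "unitary V2" "unitary V3" and "\<phi> = (V1 \<otimes>\<^sub>m V2 \<otimes>\<^sub>m V3) *v \<psi>"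
  then have "\<psi> = (dagger V1 \<otimes>\<^sub>m dagger V2 \<otimes>\<^sub>m dagger V3) *v \<phi>"
    by (simp add: matrix_vector_mul_assoc tensor_mat_mult unitary_def tensor_mat_1)
  then show "\<exists>V1 V2 V3. unitary V1 \<and> unitary V2 \<and> unitary V3 \<and> \<psi> = (V1 \<otimes>\<^sub>m V2 \<otimes>\<^sub>m V3) *v \<phi>"
    using u unitary_dagger by blast
qed

lemma LU_cnj: "LU_equivalent \<psi> \<phi> \<Longrightarrow> LU_equivalent (cnj_vec \<psi>) (cnj_vec \<phi>)"
  unfolding LU_equivalent_def
proof (elim exE conjE)
  fix V1 V2 V3 assume u: "unitary V1" "unitary V2" "unitary V3" and "\<phi> = (V1 \<otimes>\<^sub>m V2 \<otimes>\<^sub>m V3) *v \<psi>"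
  then have "cnj_vec \<phi> = (cnj_mat V1 \<otimes>\<^sub>m cnj_mat V2 \<otimes>\<^sub>m cnj_mat V3) *v cnj_vec \<psi>"
    by (simp add: vec_eq_iff cnj_vec_def matrix_vector_mult_def tensor_mat_def cnj_mat_def map_matrix_def)
  then show "\<exists>V1 V2 V3. unitary V1 \<and> unitary V2 \<and> unitary V3 \<and> cnj_vec \<phi> = (V1 \<otimes>\<^sub>m V2 \<otimes>\<^sub>m V3) *v cnj_vec \<psi>"
    using u unitary_cnj_mat by blast
qed

lemma smul_simps [simp]: "smul 1 M = M" "smul 0 M = 0"
  by (simp_all add: smul_def vec_eq_iff)

lemma mat_1_nth_2: "(mat 1 :: complex^2^2) $ 0 $ 0 = 1" "(mat 1 :: complex^2^2) $ 0 $ 1 = 0"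
  "(mat 1 :: complex^2^2) $ 1 $ 0 = 0" "(mat 1 :: complex^2^2) $ 1 $ 1 = 1"
  by (simp_all add: mat_def)

lemma LU_qubits_23:
  assumes "unitary A" "unitary B"
  shows "LU_equivalent (of_branches M N) (of_branches (A ** M ** B) (A ** N ** B))"
  unfolding LU_equivalent_def
  by (rule exI[of _ "mat 1 :: complex^2^2"], rule exI[of _ A], rule exI[of _ "transpose B"])
     (simp add: unitary_1 assms unitary_transpose tensor_mat_of_branches mat_1_nth_2)

lemma LU_qubit_1:
  fixes V :: "complex^2^2"
  assumes "unitary V"
  shows "LU_equivalent (of_branches M N)
    (of_branches (smul (V $ 0 $ 0) M + smul (V $ 0 $ 1) N) (smul (V $ 1 $ 0) M + smul (V $ 1 $ 1) N))"
  unfolding LU_equivalent_def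
  by (rule exI[of _ V], rule exI[of _ "mat 1 :: complex^2^2"], rule exI[of _ "mat 1 :: complex^2^2"])
     (simp add: unitary_1 assms tensor_mat_of_branches transpose_mat)

section \<open>Rotation angles and phases that solve scalar equations\<close>

lemma exists_angle: "\<exists>t. x * cos t + y * sin t = (0::real)"
proof -
  obtain r u where "x = r * cos u" "y = r * sin u"
    using polar_Ex by blast
  then have "x * cos (u + pi/2) + y * sin (u + pi/2) = 0"
    by (simp add: cos_add sin_add)
  then show ?thesis ..
qed

text \<open>With a half angle, \<open>c\<^sup>2 - s\<^sup>2\<close> and \<open>2 * c * s\<close> are
  a cosine and a sine. Equations of this shape arise when a plane rotation has to cancel an
  off-diagonal entry of a symmetric or Hermitian matrix.\<close>

lemma exists_rotation:
  "\<exists>c s. c\<^sup>2 + s\<^sup>2 = 1 \<and> x * (c\<^sup>2 - s\<^sup>2) + y * (c * s) = (0::real)"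
proof -
  obtain t where t: "x * cos t + y / 2 * sin t = 0"
    using exists_angle by blast
  have "cos t = (cos (t/2))\<^sup>2 - (sin (t/2))\<^sup>2" "sin t = 2 * sin (t/2) * cos (t/2)"
    using cos_double[of "t/2"] sin_double[of "t/2"] by simp_all
  then have "x * ((cos (t/2))\<^sup>2 - (sin (t/2))\<^sup>2) + y * (cos (t/2) * sin (t/2)) = 0"
    using t by (metis (no_types, lifting) mult.assoc mult.commute times_divide_eq_left nonzero_mult_div_cancel_left zero_neq_numeral)
  then show ?thesis using sin_cos_squared_add2[of "t/2"] by blast
qed

lemma unit_cnj: "cmod z = 1 \<Longrightarrow> z * cnj z = 1" "cmod z = 1 \<Longrightarrow> cnj z * z = 1"
  by (simp_all add: complex_norm_square[symmetric] mult.commute)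

lemma unit_cnj_left: "cmod z = 1 \<Longrightarrow> z * (cnj z * w) = w" "cmod z = 1 \<Longrightarrow> cnj z * (z * w) = w"
  by (simp_all add: unit_cnj mult.assoc[symmetric])

lemma unit_iff: "z * cnj z = 1 \<longleftrightarrow> cmod z = 1"
proof
  assume "z * cnj z = 1"
  then have "of_real ((cmod z)\<^sup>2) = (1::complex)" by (simp only: complex_norm_square)
  then have "(cmod z)\<^sup>2 = 1" using of_real_eq_1_iff by blast
  then show "cmod z = 1" by (simp add: power2_eq_1_iff) (metis norm_ge_zero not_one_le_zero neg_0_le_iff_le)
qed (rule unit_cnj)

lemma exists_phase: "\<exists>e. cmod e = 1 \<and> e * w = of_real (cmod w)"
proof (cases "w = 0")
  case False
  then show ?thesis
    by (intro exI[of _ "cnj w / of_real (cmod w)"])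
       (simp add: norm_divide field_simps complex_norm_square[symmetric] power2_eq_square)
qed (auto intro: exI[of _ 1])

text \<open>The square appears because a phase \<open>e\<close> on a branch multiplies its value
  under the quadratic form \<open>pdet\<close> by the square of \<open>e\<close>.\<close>

lemma exists_phase_sq: "\<exists>e. cmod e = 1 \<and> e\<^sup>2 * w = of_real (cmod w)"
proof -
  obtain e where "cmod e = 1" "e * w = of_real (cmod w)" using exists_phase by blast
  then show ?thesis
    by (intro exI[of _ "csqrt e"]) simp
qed

subsection \<open>Unitary changes of basis on the first qubit\<close>

text \<open>The local unitaries that act on qubit 1 alone. They leave the reduced state of qubits 2
  and 3 unchanged, see \<open>mixed_ptrace\<close>.\<close>

definition mixed :: "complex^2^2 \<Rightarrow> complex^2^2 \<Rightarrow> complex^2^2 \<Rightarrow> complex^2^2 \<Rightarrow> bool" where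
  "mixed M N M' N' \<longleftrightarrow> (\<exists>V :: complex^2^2. unitary V \<and>
     M' = smul (V $ 0 $ 0) M + smul (V $ 0 $ 1) N \<and> N' = smul (V $ 1 $ 0) M + smul (V $ 1 $ 1) N)"

lemma mixedI:
  assumes "cnj a * a + cnj c * c = 1" "cnj b * b + cnj d * d = 1" "cnj a * b + cnj c * d = 0"
  shows "mixed M N (smul a M + smul b N) (smul c M + smul d N)"
  unfolding mixed_def using assms by (intro exI[of _ "mat2 a b c d"]) (simp add: unitary_mat2_iff)

lemma mixed_trans:
  assumes "mixed M N M' N'" "mixed M' N' M'' N''"
  shows "mixed M N M'' N''"
proof -
  obtain V W :: "complex^2^2" where "unitary V" "unitary W"
    and "M' = smul (V $ 0 $ 0) M + smul (V $ 0 $ 1) N" "N' = smul (V $ 1 $ 0) M + smul (V $ 1 $ 1) N"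
    and "M'' = smul (W $ 0 $ 0) M' + smul (W $ 0 $ 1) N'" "N'' = smul (W $ 1 $ 0) M' + smul (W $ 1 $ 1) N'"
    using assms unfolding mixed_def by blast
  moreover from this have "unitary (W ** V)" by (simp add: unitary_mult)
  ultimately show ?thesis
    unfolding mixed_def
    by (intro exI[of _ "W ** V"] conjI)
       (simp_all add: smul_def vec_eq_iff matrix_matrix_mult_def sum_2' algebra_simps)
qed

lemma mixed_LU: "mixed M N M' N' \<Longrightarrow> LU_equivalent (of_branches M N) (of_branches M' N')"
  unfolding mixed_def using LU_qubit_1 by blast

lemma mixed_phases: "cmod p = 1 \<Longrightarrow> cmod q = 1 \<Longrightarrow> mixed M N (smul p M) (smul q N)"
  using mixedI[of p 0 0 q M N] by (simp add: unit_cnj)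

lemma mixed_swap: "mixed M N N M"
  using mixedI[of 0 1 1 0 M N] by simp

lemma pdet_smul: "pdet (smul a M) (smul b N) = a * b * pdet M N"
  by (simp add: pdet_def smul_def algebra_simps)

lemma frob_smul: "frob (smul a M) (smul b N) = cnj a * b * frob M N"
  by (simp add: frob_def smul_def algebra_simps)

text \<open>Takagi factorization of the symmetric matrix with entries \<^term>\<open>pdet\<close>.\<close>

lemma takagi:
  "\<exists>M' N' l1 l2. mixed M N M' N' \<and> l1 \<ge> l2 \<and> l2 \<ge> 0 \<and>
     pdet M' M' = of_real l1 \<and> pdet N' N' = of_real l2 \<and> pdet M' N' = 0"
proof -
  define x where "x = pdet M M"
  define y where "y = pdet M N"
  define z where "z = pdet N N"
  obtain u where u: "cmod u = 1" "u * y = of_real (cmod y)" using exists_phase by blast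
  \<comment> \<open>The off-diagonal value after a rotation with parameters \<open>c\<close>,
    \<open>s\<close>, \<open>e\<close> has the coefficient \<open>e * u * z - cnj e * u * x\<close>
    at \<open>c * s\<close>. This \<open>e\<close> makes it real; as \<open>u * y\<close> is real
    too, a single real equation for \<open>c\<close> and \<open>s\<close> remains.\<close>
  obtain e where e: "cmod e = 1" "e * (u * z + cnj (u * x)) = of_real (cmod (u * z + cnj (u * x)))"
    using exists_phase by blast
  define k where "k = Re (e * u * z - cnj e * u * x)"
  have "Im (e * u * z - cnj e * u * x) = Im (e * (u * z + cnj (u * x)))"
    by (simp add: algebra_simps)
  also have "\<dots> = 0" unfolding e(2) by simp
  finally have k: "e * u * z - cnj e * u * x = of_real k"
    unfolding k_def by (simp add: complex_eq_iff)
  obtain c s where cs: "c\<^sup>2 + s\<^sup>2 = 1" "cmod y * (c\<^sup>2 - s\<^sup>2) + k * (c * s) = 0"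
    using exists_rotation by blast
  have cs1: "of_real c * of_real c + of_real s * of_real s = (1::complex)"
    using arg_cong[OF cs(1), of complex_of_real] by (simp add: power2_eq_square)
  define M1 where "M1 = smul (of_real c) M + smul (of_real s * e) N"
  define N1 where "N1 = smul (- of_real s * cnj e) M + smul (of_real c) N"
  have mix1: "mixed M N M1 N1"
    unfolding M1_def N1_def using cs1 unit_cnj(1)[OF e(1)]
    by (intro mixedI; simp; algebra)
  have "u * pdet M1 N1 = of_real (c\<^sup>2 - s\<^sup>2) * (u * y) + of_real (c * s) * (e * u * z - cnj e * u * x)"
    unfolding M1_def N1_def pdet_lin pdet_comm[of N M] x_def[symmetric] y_def[symmetric] z_def[symmetric]
    using unit_cnj(1)[OF e(1)] by (simp, algebra)
  also have "\<dots> = of_real (cmod y * (c\<^sup>2 - s\<^sup>2) + k * (c * s))"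
    unfolding k u(2) by (simp add: mult.commute)
  finally have "u * pdet M1 N1 = 0" using cs(2) by simp
  then have off: "pdet M1 N1 = 0" using u(1) by auto
  \<comment> \<open>The matrix of \<tau> is now diagonal; phases on the branches make its entries
    nonnegative, and an exchange of the branches will order them.\<close>
  obtain p where p: "cmod p = 1" "p\<^sup>2 * pdet M1 M1 = of_real (cmod (pdet M1 M1))"
    using exists_phase_sq by blast
  obtain q where q: "cmod q = 1" "q\<^sup>2 * pdet N1 N1 = of_real (cmod (pdet N1 N1))"
    using exists_phase_sq by blast
  define M2 where "M2 = smul p M1"
  define N2 where "N2 = smul q N1"
  have mix2: "mixed M N M2 N2"
    using mix1 mixed_phases[OF p(1) q(1)] mixed_trans unfolding M2_def N2_def by blast
  have 2: "pdet M2 M2 = of_real (cmod (pdet M1 M1))" "pdet N2 N2 = of_real (cmod (pdet N1 N1))" "pdet M2 N2 = 0"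
    using p q off unfolding M2_def N2_def pdet_smul by (simp_all add: power2_eq_square)
  show ?thesis
  proof (cases "cmod (pdet M1 M1) \<ge> cmod (pdet N1 N1)")
    case True
    with mix2 2 show ?thesis using norm_ge_zero by blast
  next
    case False
    have "mixed M N N2 M2" using mix2 mixed_swap mixed_trans by blast
    moreover have "pdet N2 M2 = 0" using 2 pdet_comm by metis
    ultimately show ?thesis using False 2 norm_ge_zero by (metis linear)
  qed
qed

subsection \<open>Special unitary matrices\<close>

text \<open>Determinant one makes the two-sided action preserve \<open>pdet\<close> exactly and not
  just up to a phase.\<close>

definition special :: "complex^2^2 \<Rightarrow> bool" where
  "special A \<longleftrightarrow> unitary A \<and> det A = 1"

lemma special_mat2: "p * cnj p + q * cnj q = 1 \<Longrightarrow> special (mat2 p q (- cnj q) (cnj p))"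
  unfolding special_def by (simp add: unitary_mat2_iff mult.commute add.commute)

text \<open>The inverse of a unitary matrix is its adjoint, and for determinant one it is also the
  adjugate; comparing the two gives this shape.\<close>

lemma special_cases:
  assumes "special A"
  obtains p q where "A = mat2 p q (- cnj q) (cnj p)" "p * cnj p + q * cnj q = 1"
proof -
  obtain a b c d where A: "A = mat2 a b c d" by (rule mat2_cases)
  have u: "cnj a * a + cnj c * c = 1" "cnj b * b + cnj d * d = 1" "cnj a * b + cnj c * d = 0"
    and d: "a * d - b * c = 1"
    using assms by (auto simp: A special_def unitary_mat2_iff)
  have "d = (cnj a * a + cnj c * c) * d" by (simp add: u)
  also have "\<dots> = cnj a * (a * d - b * c) + c * (cnj a * b + cnj c * d)" by (simp add: algebra_simps)
  finally have da: "d = cnj a" using u d by simp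
  have "b = (cnj a * a + cnj c * c) * b" by (simp add: u)
  also have "\<dots> = a * (cnj a * b + cnj c * d) - cnj c * (a * d - b * c)" by (simp add: algebra_simps)
  finally have "b = - cnj c" using u d by simp
  with da u have "A = mat2 a b (- cnj b) (cnj a)" "a * cnj a + b * cnj b = 1"
    by (auto simp: A mult.commute)
  then show ?thesis using that by blast
qed

lemma special_mult: "special A \<Longrightarrow> special B \<Longrightarrow> special (A ** B)"
  unfolding special_def by (simp add: unitary_mult det_mul)

lemma special_dagger: "special A \<Longrightarrow> special (dagger A)"
  unfolding special_def using unitary_dagger
  by (metis det_I det_mul mult.right_neutral unitary_def)

text \<open>A singular value decomposition in which no phase is left over, since the determinant is
  already nonnegative. \<open>A\<close> makes the rows orthogonal and puts the longer one first;
  \<open>B\<close> turns the first row into a multiple of the first basis vector.\<close>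

lemma special_svd:
  assumes "det M = of_real d" "d \<ge> 0"
  shows "\<exists>A B s t. special A \<and> special B \<and> s \<ge> t \<and> t \<ge> 0 \<and> A ** M ** B = mat2 (of_real s) 0 0 (of_real t)"
proof -
  obtain a1 a2 a3 a4 where M: "M = mat2 a1 a2 a3 a4" by (rule mat2_cases)
  \<comment> \<open>\<open>y\<close> is the off-diagonal entry of \<open>M ** dagger M\<close>, and
    \<open>k\<close> is the second diagonal entry minus the first.\<close>
  define y where "y = a1 * cnj a3 + a2 * cnj a4"
  define k where "k = (cmod a3)\<^sup>2 + (cmod a4)\<^sup>2 - (cmod a1)\<^sup>2 - (cmod a2)\<^sup>2"
  have k: "of_real k = a3 * cnj a3 + a4 * cnj a4 - a1 * cnj a1 - a2 * cnj a2"
    unfolding k_def by (simp only: of_real_add of_real_diff complex_norm_square)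
  obtain e where e: "cmod e = 1" "e * y = of_real (cmod y)" using exists_phase by blast
  obtain c s where cs: "c\<^sup>2 + s\<^sup>2 = 1" "cmod y * (c\<^sup>2 - s\<^sup>2) + k * (c * s) = 0"
    using exists_rotation by blast
  have cs1: "of_real c * of_real c + of_real s * of_real s = (1::complex)"
    using arg_cong[OF cs(1), of complex_of_real] by (simp add: power2_eq_square)
  define A1 where "A1 = mat2 (of_real c) (of_real s * cnj e) (- of_real s * e) (of_real c)"
  have "of_real c * cnj (of_real c) + (of_real s * cnj e) * cnj (of_real s * cnj e) = 1"
    using cs1 unit_cnj(1)[OF e(1)] by (simp; algebra)
  from special_mat2[OF this] have A1: "special A1"
    unfolding A1_def by simp
  obtain b1 b2 b3 b4 where N: "A1 ** M = mat2 b1 b2 b3 b4" by (rule mat2_cases)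
  have e': "cnj e * cnj y = of_real (cmod y)" using arg_cong[OF e(2), of cnj] by simp
  have e'': "y = cnj e * of_real (cmod y)" "cnj y = e * of_real (cmod y)"
    using unit_cnj_left[OF e(1)] e e' by metis+
  have "b1 * cnj b3 + b2 * cnj b4 =
     cnj e * (of_real c * of_real c * (e * y) - of_real s * of_real s * (cnj e * cnj y) + of_real c * of_real s * of_real k)"
  proof -
    have "b1 = of_real c * a1 + of_real s * cnj e * a3" "b2 = of_real c * a2 + of_real s * cnj e * a4"
      "b3 = - of_real s * e * a1 + of_real c * a3" "b4 = - of_real s * e * a2 + of_real c * a4"
      using N unfolding A1_def M by auto
    then show ?thesis unfolding k y_def using unit_cnj(1)[OF e(1)] by (simp; algebra)
  qed
  also have "\<dots> = cnj e * of_real (cmod y * (c\<^sup>2 - s\<^sup>2) + k * (c * s))"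
    unfolding e e' by (simp add: algebra_simps power2_eq_square)
  finally have orth: "b1 * cnj b3 + b2 * cnj b4 = 0" using cs(2) by simp
  have "\<exists>A c1 c2 c3 c4. special A \<and> A ** M = mat2 c1 c2 c3 c4 \<and> c1 * cnj c3 + c2 * cnj c4 = 0
      \<and> (cmod c1)\<^sup>2 + (cmod c2)\<^sup>2 \<ge> (cmod c3)\<^sup>2 + (cmod c4)\<^sup>2"
  proof (cases "(cmod b1)\<^sup>2 + (cmod b2)\<^sup>2 \<ge> (cmod b3)\<^sup>2 + (cmod b4)\<^sup>2")
    case True
    then show ?thesis using A1 N orth by blast
  next
    case False
    \<comment> \<open>The exchange of the rows carries a sign in order to keep determinant
      one.\<close>
    have "special (mat2 0 1 (-1) 0)" using special_mat2[of 0 1] by simp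
    then have "special (mat2 0 1 (-1) 0 ** A1)" using A1 special_mult by blast
    moreover have "mat2 0 1 (-1) 0 ** A1 ** M = mat2 b3 b4 (-b1) (-b2)"
      unfolding matrix_mul_assoc[symmetric] N by simp
    moreover have "b3 * cnj b1 + b4 * cnj b2 = 0"
      using arg_cong[OF orth, of cnj] by (simp add: mult.commute)
    ultimately show ?thesis using False
      by (intro exI[of _ "mat2 0 1 (-1) 0 ** A1"] exI) (auto simp: add_eq_0_iff)
  qed
  then obtain A c1 c2 c3 c4 where A: "special A" and P: "A ** M = mat2 c1 c2 c3 c4"
    and orth: "c1 * cnj c3 + c2 * cnj c4 = 0"
    and ord: "(cmod c1)\<^sup>2 + (cmod c2)\<^sup>2 \<ge> (cmod c3)\<^sup>2 + (cmod c4)\<^sup>2" by blast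
  define n where "n = sqrt ((cmod c1)\<^sup>2 + (cmod c2)\<^sup>2)"
  have det: "c1 * c4 - c2 * c3 = of_real d"
    using arg_cong[OF P, of det] A assms by (simp add: det_mul special_def)
  show ?thesis
  proof (cases "n = 0")
    case True
    then have "(cmod c1)\<^sup>2 + (cmod c2)\<^sup>2 = 0" by (simp add: n_def)
    then have "c1 = 0" "c2 = 0" "c3 = 0" "c4 = 0" using ord
      by (auto simp: sum_power2_eq_zero_iff add_nonneg_eq_0_iff order_antisym_conv)
    then have "A ** M ** mat 1 = mat2 (of_real 0) 0 0 (of_real 0)" by (simp add: P)
    moreover have "special (mat 1)" by (simp add: special_def unitary_1)
    ultimately show ?thesis using A by blast
  next
    case False
    moreover have "n \<ge> 0" by (simp add: n_def)
    ultimately have n: "n > 0" by simp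
    have n2: "of_real n * of_real n = c1 * cnj c1 + c2 * cnj c2"
    proof -
      have "n * n = (cmod c1)\<^sup>2 + (cmod c2)\<^sup>2" by (simp add: n_def)
      then have "of_real n * of_real n = complex_of_real ((cmod c1)\<^sup>2 + (cmod c2)\<^sup>2)"
        by (metis of_real_mult)
      then show ?thesis by (simp only: of_real_add complex_norm_square)
    qed
    \<comment> \<open>The first column is the conjugate of the normalized first row. Orthogonality
      of the rows then clears the lower left entry, and the determinant fixes the last one as
      \<open>d / n\<close>.\<close>
    define B where "B = mat2 (cnj c1 / of_real n) (- c2 / of_real n) (cnj c2 / of_real n) (c1 / of_real n)"
    have "(c1 * cnj c1 + c2 * cnj c2) / (of_real n * of_real n) = 1"
      using n by (simp add: n2[symmetric])
    then have B: "special B"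
      unfolding B_def using special_mat2[of "cnj c1 / of_real n" "- c2 / of_real n"]
      by (simp add: add_divide_distrib mult.commute)
    have orth': "c3 * cnj c1 + c4 * cnj c2 = 0"
      using arg_cong[OF orth, of cnj] by (simp add: mult.commute)
    have AMB: "A ** M ** B = mat2 (of_real n) 0 0 (of_real (d / n))"
      unfolding P B_def mat2_mult mat2_eq_iff
    proof (intro conjI)
      show "c1 * (cnj c1 / of_real n) + c2 * (cnj c2 / of_real n) = of_real n"
        using n n2 by (simp add: add_divide_distrib[symmetric]) (simp add: n2[symmetric])
      show "c1 * (- c2 / of_real n) + c2 * (c1 / of_real n) = 0" by simp
      show "c3 * (cnj c1 / of_real n) + c4 * (cnj c2 / of_real n) = 0"
        using orth' by (simp add: add_divide_distrib[symmetric])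
      show "c3 * (- c2 / of_real n) + c4 * (c1 / of_real n) = of_real (d / n)"
        unfolding of_real_divide det[symmetric] by (simp add: diff_divide_distrib mult.commute)
    qed
    \<comment> \<open>Invariance of the Frobenius norm identifies \<open>d / n\<close> with the
      length of the second row, which is at most \<open>n\<close>.\<close>
    have "frob (A ** M ** B) (A ** M ** B) = frob (A ** M) (A ** M)"
      using frob_two_sided[OF unitary_1, of B "A ** M" "A ** M"] B by (simp add: special_def)
    then have "of_real (n\<^sup>2 + (d/n)\<^sup>2) = complex_of_real ((cmod c1)\<^sup>2 + (cmod c2)\<^sup>2 + (cmod c3)\<^sup>2 + (cmod c4)\<^sup>2)"
      unfolding AMB unfolding P by (simp only: frob_mat2 of_real_add complex_norm_square) (simp add: power2_eq_square mult.commute)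
    then have "n\<^sup>2 + (d/n)\<^sup>2 = (cmod c1)\<^sup>2 + (cmod c2)\<^sup>2 + (cmod c3)\<^sup>2 + (cmod c4)\<^sup>2"
      using of_real_eq_iff by blast
    moreover have "n\<^sup>2 = (cmod c1)\<^sup>2 + (cmod c2)\<^sup>2" by (simp add: n_def)
    ultimately have "(d/n)\<^sup>2 \<le> n\<^sup>2" using ord by simp
    then have "d/n \<le> n" using n power2_le_imp_le by fastforce
    moreover have "d / n \<ge> 0" using n assms by simp
    ultimately show ?thesis using A B AMB by blast
  qed
qed

subsection \<open>Rotations and Euler angles\<close>

lemma sums_mat2I:
  assumes "a sums a'" "b sums b'" "c sums c'" "d sums d'"
  shows "(\<lambda>n. mat2 (a n) (b n) (c n) (d n)) sums mat2 a' b' c' d'"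
proof -
  have "(\<lambda>k. \<Sum>n<k. mat2 (a n) (b n) (c n) (d n)) =
    (\<lambda>k. mat2 (\<Sum>n<k. a n) (\<Sum>n<k. b n) (\<Sum>n<k. c n) (\<Sum>n<k. d n))"
    by (simp add: mat_eq_iff_2 fun_eq_iff)
  also have "\<dots> \<longlonglongrightarrow> mat2 a' b' c' d'"
    unfolding mat2_def using assms unfolding sums_def
    by (intro tendsto_vec_lambda) auto
  finally show ?thesis by (simp add: sums_def)
qed

lemma scaleR_mat2 [simp]: "r *\<^sub>R mat2 a b c d = mat2 (of_real r * a) (of_real r * b) (of_real r * c) (of_real r * d)"
  by (simp add: mat_eq_iff_2 scaleR_conv_of_real[where 'a=complex])

lemma exp_sums: "(\<lambda>n. of_real (1 / fact n) * z ^ n) sums exp z" for z :: complex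
  using exp_converges[of z] by (simp add: scaleR_conv_of_real divide_inverse)

lemma rotZ_eq: "rotZ x = mat2 (cis x) 0 0 (cis (- x))"
proof -
  define w where "w = \<i> * complex_of_real x"
  have A: "map_matrix (\<lambda>z. \<i> * of_real x * z) sigma_z = mat2 w 0 0 (- w)"
    by (simp add: mat_eq_iff_2 map_matrix_def sigma_z_def w_def)
  have pow: "mat_pow (mat2 w 0 0 (- w)) n = mat2 (w ^ n) 0 0 ((- w) ^ n)" for n
    by (induction n) (simp_all add: mat_1_mat2)
  have "(\<lambda>n. (1 / fact n) *\<^sub>R mat_pow (mat2 w 0 0 (- w)) n) sums mat2 (exp w) 0 0 (exp (- w))"
    unfolding pow scaleR_mat2 using exp_sums by (intro sums_mat2I) simp_all
  then show ?thesis
    unfolding rotZ_def mat_exp_def A by (simp add: sums_unique[symmetric] cis_conv_exp w_def)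
qed

lemma rotY_eq: "rotY x = mat2 (of_real (cos x)) (of_real (sin x)) (- of_real (sin x)) (of_real (cos x))"
proof -
  define w where "w = \<i> * complex_of_real x"
  have A: "map_matrix (\<lambda>z. \<i> * of_real x * z) sigma_y = mat2 0 (- \<i> * w) (\<i> * w) 0"
    by (simp add: mat_eq_iff_2 map_matrix_def sigma_y_def w_def complex_eq_iff)
  \<comment> \<open>The square of this matrix is \<open>w\<^sup>2\<close> times the identity, so
    even powers are diagonal and odd powers off-diagonal; the sums and differences with
    \<open>- w\<close> select the parity.\<close>
  have pow: "mat_pow (mat2 0 (- \<i> * w) (\<i> * w) 0) n =
    mat2 ((w ^ n + (- w) ^ n) / 2) (- \<i> * (w ^ n - (- w) ^ n) / 2) (\<i> * (w ^ n - (- w) ^ n) / 2) ((w ^ n + (- w) ^ n) / 2)" for n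
    by (induction n) (simp_all add: mat_1_mat2 field_simps)
  have "(\<lambda>n. (1 / fact n) *\<^sub>R mat_pow (mat2 0 (- \<i> * w) (\<i> * w) 0) n) sums
    mat2 ((exp w + exp (- w)) / 2) (- \<i> * (exp w - exp (- w)) / 2) (\<i> * (exp w - exp (- w)) / 2) ((exp w + exp (- w)) / 2)"
  proof -
    have 1: "(\<lambda>n. (of_real (1 / fact n) * w ^ n + of_real (1 / fact n) * (- w) ^ n) / 2) sums ((exp w + exp (- w)) / 2)"
      by (intro sums_divide sums_add exp_sums)
    have 2: "(\<lambda>n. k * (of_real (1 / fact n) * w ^ n - of_real (1 / fact n) * (- w) ^ n) / 2) sums (k * (exp w - exp (- w)) / 2)" for k
      by (intro sums_divide sums_mult sums_diff exp_sums)
    show ?thesis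
      unfolding pow scaleR_mat2 using 1 2[of "- \<i>"] 2[of \<i>]
      by (intro sums_mat2I) (simp_all add: algebra_simps)
  qed
  moreover have "exp w = cis x" "exp (- w) = cis (- x)"
    by (simp_all add: cis_conv_exp w_def)
  then have "mat2 ((exp w + exp (- w)) / 2) (- \<i> * (exp w - exp (- w)) / 2) (\<i> * (exp w - exp (- w)) / 2) ((exp w + exp (- w)) / 2)
     = mat2 (of_real (cos x)) (of_real (sin x)) (- of_real (sin x)) (of_real (cos x))"
    by (simp add: complex_eq_iff)
  ultimately show ?thesis
    unfolding rotY_def mat_exp_def A by (simp add: sums_unique[symmetric])
qed

text \<open>The moduli of the first row are a cosine and a sine of one angle in the first quadrant;
  half the sum and half the difference of the arguments are the outer angles.\<close>

lemma euler_angles: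
  assumes "special U"
  shows "\<exists>x t z. 0 \<le> t \<and> t \<le> pi / 2 \<and> U = rotZ x ** rotY t ** rotZ z"
proof -
  obtain p q where U: "U = mat2 p q (- cnj q) (cnj p)" and pq: "p * cnj p + q * cnj q = 1"
    using assms by (rule special_cases)
  have "of_real ((cmod p)\<^sup>2 + (cmod q)\<^sup>2) = (1::complex)"
    using pq by (simp only: of_real_add complex_norm_square)
  then have "(cmod p)\<^sup>2 + (cmod q)\<^sup>2 = 1" using of_real_eq_1_iff by blast
  then obtain t where t: "0 \<le> t" "t \<le> pi / 2" "cmod p = cos t" "cmod q = sin t"
    using sincos_total_pi_half[of "cmod p" "cmod q"] by auto
  define u where "u = Arg p"
  define v where "v = Arg q"
  have p: "p = of_real (cos t) * cis u" and q: "q = of_real (sin t) * cis v"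
    using rcis_cmod_Arg[of p] rcis_cmod_Arg[of q] by (simp_all add: t u_def v_def rcis_def)
  have "U = rotZ ((u + v) / 2) ** rotY t ** rotZ ((u - v) / 2)"
    unfolding U p q rotZ_eq rotY_eq
    by (simp add: cis_mult cis_cnj mult.assoc[symmetric] mult.commute[of "cis _" "of_real _"])
       (simp add: mult.assoc cis_mult add_divide_distrib diff_divide_distrib)
  then show ?thesis using t by blast
qed

lemma angle_mod_pi: "\<exists>y\<in>{- pi / 2<..pi / 2}. \<exists>\<epsilon>\<in>{1, - 1}. cis x = \<epsilon> * cis y"
proof -
  \<comment> \<open>Rounding up yields the interval that is open on the left and closed on the
    right.\<close>
  define k where "k = \<lceil>x / pi - 1 / 2\<rceil>"
  define y where "y = x - k * pi"
  have "k - 1 < x / pi - 1/2" "x / pi - 1 / 2 \<le> k"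
    unfolding k_def by linarith+
  then have "y \<in> {- pi / 2<..pi / 2}"
    by (auto simp: y_def field_simps)
  moreover have "cis (k * pi) \<in> {1, -1}"
    by (cases "even k") (auto simp: complex_eq_iff elim!: evenE oddE simp: algebra_simps)
  moreover have "cis x = cis (k * pi) * cis y"
    by (simp add: cis_mult y_def)
  ultimately show ?thesis by blast
qed

text \<open>The angle range of a decomposition is only a half turn; the leftover sign is later
  absorbed by a phase on qubit 1.\<close>

lemma rotZ_mod_pi: "\<exists>y\<in>{- pi / 2<..pi / 2}. \<exists>\<epsilon>\<in>{1, - 1}. rotZ x = smul \<epsilon> (rotZ y)"
proof -
  obtain y \<epsilon> where y: "y \<in> {- pi / 2<..pi / 2}" "\<epsilon> \<in> {1, - 1::complex}" "cis x = \<epsilon> * cis y"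
    using angle_mod_pi by blast
  have "cis (- x) = \<epsilon> * cis (- y)"
    using arg_cong[OF y(3), of cnj] y(2) by (auto simp: cis_cnj)
  with y show ?thesis unfolding rotZ_eq by (intro bexI[of _ y] bexI[of _ \<epsilon>]) simp_all
qed

lemma special_rotZ: "special (rotZ x)"
  unfolding rotZ_eq using special_mat2[of "cis x" 0] by (simp add: cis_cnj cis_mult)

lemma special_rotY: "special (rotY x)"
  unfolding rotY_eq using special_mat2[of "of_real (cos x)" "of_real (sin x)"]
  by (simp add: power2_eq_square[symmetric] flip: of_real_power of_real_add)

lemma rotZ_add: "rotZ x ** rotZ y = rotZ (x + y)"
  by (simp add: rotZ_eq cis_mult add.commute)

lemma rotZ_0: "rotZ 0 = mat 1"
  by (simp add: rotZ_eq mat_1_mat2)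

lemma rotZ_diag_commute: "rotZ x ** mat2 a 0 0 d = mat2 a 0 0 d ** rotZ x"
  by (simp add: rotZ_eq mult.commute)

subsection \<open>The standard form\<close>

text \<open>The coefficient matrix of the second branch, with \<open>a\<close> and \<open>b\<close>
  not assumed normalized, so that the prefactor 1/sqrt 2 can be moved into them.\<close>

definition std_branch :: "real \<Rightarrow> real \<Rightarrow> real \<Rightarrow> real \<Rightarrow> real \<Rightarrow> real \<Rightarrow> complex^2^2" where
  "std_branch a b \<alpha> \<beta> \<gamma> \<beta>' =
    rotZ \<alpha> ** rotY \<beta> ** rotZ \<gamma> ** mat2 (of_real a) 0 0 (of_real b) ** transpose (rotY \<beta>')"

lemma std_state_eq:
  "(1 / sqrt 2) *\<^sub>R (ket 0 \<otimes>\<^sub>v psi_s a b +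
      ket 1 \<otimes>\<^sub>v (((rotZ \<alpha> ** rotY \<beta> ** rotZ \<gamma>) \<otimes>\<^sub>m rotY \<beta>') *v psi_s a b)) =
   of_branches (smul (of_real (1 / sqrt 2)) (mat2 (of_real a) 0 0 (of_real b)))
     (smul (of_real (1 / sqrt 2)) (std_branch a b \<alpha> \<beta> \<gamma> \<beta>'))"
proof -
  have psi: "psi_s a b $ (j, k) = mat2 (of_real a) 0 0 (of_real b) $ j $ k" for j k
    by (auto simp: psi_s_def ket_def tensor_vec_def axis_def mat2_def scaleR_conv_of_real[where 'a=complex] neq_zero_iff_2)
  have "((U \<otimes>\<^sub>m W) *v psi_s a b) $ (j, k) = (U ** mat2 (of_real a) 0 0 (of_real b) ** transpose W) $ j $ k"
    for U W :: "complex^2^2" and j k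
    by (simp add: matrix_vector_mult_def sum_UNIV_prod tensor_mat_def psi sum_2' matrix_matrix_mult_def
       transpose_def algebra_simps)
  then show ?thesis
    by (auto simp: vec_eq_iff of_branches_def tensor_vec_def psi smul_def std_branch_def ket_def axis_def
      scaleR_conv_of_real[where 'a=complex] neq_zero_iff_2)
qed

lemma smul_mult: "smul k M ** N = smul k (M ** N)" "M ** smul k N = smul k (M ** N)"
  by (simp_all add: smul_def vec_eq_iff matrix_matrix_mult_def sum_distrib_left mult.left_commute mult.assoc)

lemma smul_smul: "smul k (smul l M) = smul (k * l) M"
  by (simp add: smul_def vec_eq_iff mult.assoc)

lemma smul_diag: "smul (of_real k) (mat2 (of_real a) 0 0 (of_real b)) = mat2 (of_real (k * a)) 0 0 (of_real (k * b))"
  by simp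

lemma smul_std_branch: "smul (of_real k) (std_branch a b \<alpha> \<beta> \<gamma> \<beta>') = std_branch (k * a) (k * b) \<alpha> \<beta> \<gamma> \<beta>'"
  unfolding std_branch_def smul_diag[symmetric] smul_mult ..

lemma pdet_self: "pdet M M = 2 * det M"
  by (rule mat2_cases[of M]) simp

lemma transpose_rotZ: "transpose (rotZ x) = rotZ x"
  by (simp add: rotZ_eq)

lemma special_transpose: "special A \<Longrightarrow> special (transpose A)"
  by (simp add: special_def unitary_transpose)

text \<open>The data fix the squares of \<open>s + t\<close> and \<open>s - t\<close>, both of which
  are nonnegative.\<close>

lemma diag_entries_unique:
  fixes s t s' t' :: real
  assumes "s \<ge> t" "t \<ge> 0" "s' \<ge> t'" "t' \<ge> 0" "s\<^sup>2 + t\<^sup>2 = s'\<^sup>2 + t'\<^sup>2" "s * t = s' * t'"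
  shows "s = s' \<and> t = t'"
proof -
  have "(s + t)\<^sup>2 = (s' + t')\<^sup>2" "(s - t)\<^sup>2 = (s' - t')\<^sup>2"
    using assms(5,6) by (simp_all add: power2_eq_square algebra_simps)
  then have "s + t = s' + t'" "s - t = s' - t'"
    using assms(1-4) by (simp_all add: power2_eq_iff_nonneg)
  then show ?thesis by simp
qed

text \<open>Equal norms and equal determinants force equal singular values, so both branches reduce
  to one diagonal matrix \<open>D\<close>. Unitaries on qubits 2 and 3 then reach \<open>D\<close>
  and \<open>U ** D ** W\<close>, and Euler angles of \<open>U\<close> and \<open>W\<close> supply
  the parameters.\<close>

lemma decomposition_exists:
  assumes "frob M M = 1/2" "frob N N = 1/2" "pdet M M = of_real c" "pdet N N = of_real c" "c \<ge> 0"
  shows "\<exists>a b \<alpha> \<beta> \<gamma> \<beta>'. is_decomposition (of_branches M N) a b \<alpha> \<beta> \<gamma> \<beta>' \<and> a * b = c"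
proof -
  have svd: "\<exists>A B s t. special A \<and> special B \<and> s \<ge> t \<and> t \<ge> 0 \<and>
      A ** K ** B = mat2 (of_real s) 0 0 (of_real t) \<and> s\<^sup>2 + t\<^sup>2 = 1/2 \<and> 2 * (s * t) = c"
    if K: "frob K K = 1/2" "pdet K K = of_real c" for K
  proof -
    have "det K = of_real (c / 2)" using K(2) by (simp add: pdet_self field_simps)
    then obtain A B s t where *: "special A" "special B" "s \<ge> t" "t \<ge> 0"
       "A ** K ** B = mat2 (of_real s) 0 0 (of_real t)"
      using special_svd[of K "c / 2"] assms(5) by auto
    have "frob (A ** K ** B) (A ** K ** B) = 1/2"
      using frob_two_sided[of A B K K] * K by (simp add: special_def)
    then have "complex_of_real (s\<^sup>2 + t\<^sup>2) = of_real (1/2)"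
      unfolding *(5) by (simp add: power2_eq_square)
    then have 1: "s\<^sup>2 + t\<^sup>2 = 1/2" using of_real_eq_iff by blast
    have "pdet (A ** K ** B) (A ** K ** B) = of_real c"
      using pdet_two_sided[of A K B K] * K by (simp add: special_def)
    then have "complex_of_real (2 * (s * t)) = of_real c"
      unfolding *(5) by simp
    then have "2 * (s * t) = c" using of_real_eq_iff by blast
    then show ?thesis using * 1 by blast
  qed
  obtain A B s t where 1: "special A" "special B" "s \<ge> t" "t \<ge> 0"
      "A ** M ** B = mat2 (of_real s) 0 0 (of_real t)" "s\<^sup>2 + t\<^sup>2 = 1/2" "2 * (s * t) = c"
    using svd[of M] assms by blast
  obtain A' B' s' t' where 2: "special A'" "special B'" "s' \<ge> t'" "t' \<ge> 0"
      "A' ** N ** B' = mat2 (of_real s') 0 0 (of_real t')" "s'\<^sup>2 + t'\<^sup>2 = 1/2" "2 * (s' * t') = c"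
    using svd[of N] assms by blast
  have [simp]: "s' = s" "t' = t"
    using diag_entries_unique[of t s t' s'] 1 2 by simp_all
  define D where "D = mat2 (of_real s) 0 0 (of_real t)"
  define U where "U = A ** dagger A'"
  define W where "W = dagger B' ** B"
  have UW: "special U" "special W"
    unfolding U_def W_def using 1 2 by (simp_all add: special_mult special_dagger)
  have "A ** N ** B = U ** D ** W"
  proof -
    have "U ** D ** W = A ** (dagger A' ** A') ** N ** (B' ** dagger B') ** B"
      unfolding U_def W_def D_def 2(5)[symmetric, simplified] by (simp add: matrix_mul_assoc)
    then show ?thesis using 2(1,2) by (simp add: special_def unitary_def)
  qed
  then have LU1: "LU_equivalent (of_branches M N) (of_branches D (U ** D ** W))"
    using LU_qubits_23[of A B M N] 1 by (simp add: special_def D_def)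
  \<comment> \<open>The transpose is decomposed because the unitary of qubit 3 acts through it. Of
    the two outer rotations of \<open>W\<close>, \<open>rotZ z\<close> commutes past
    \<open>D\<close> into \<open>U\<close>, and \<open>rotZ x\<close> is cancelled by conjugating
    both branches with \<open>rotZ x\<close>, which fixes \<open>D\<close>.\<close>
  obtain x \<beta>' z where b': "0 \<le> \<beta>'" "\<beta>' \<le> pi / 2" "transpose W = rotZ x ** rotY \<beta>' ** rotZ z"
    using euler_angles special_transpose UW(2) by blast
  have W: "W = rotZ z ** transpose (rotY \<beta>') ** rotZ x"
    using arg_cong[OF b'(3), of transpose] by (simp add: matrix_transpose_mul transpose_rotZ matrix_mul_assoc)
  have "special (rotZ x ** U ** rotZ z)"
    by (intro special_mult special_rotZ UW)
  then obtain x1 \<beta> z1 where b: "0 \<le> \<beta>" "\<beta> \<le> pi / 2" "rotZ x ** U ** rotZ z = rotZ x1 ** rotY \<beta> ** rotZ z1"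
    using euler_angles by blast
  obtain \<alpha> \<epsilon> where al: "\<alpha> \<in> {- pi / 2<..pi / 2}" "\<epsilon> \<in> {1, -1}" "rotZ x1 = smul \<epsilon> (rotZ \<alpha>)"
    using rotZ_mod_pi by blast
  obtain \<gamma> \<eta> where ga: "\<gamma> \<in> {- pi / 2<..pi / 2}" "\<eta> \<in> {1, -1}" "rotZ z1 = smul \<eta> (rotZ \<gamma>)"
    using rotZ_mod_pi by blast
  have c1: "rotZ x ** D ** rotZ (- x) = D"
    unfolding D_def rotZ_diag_commute matrix_mul_assoc[symmetric] rotZ_add by (simp add: rotZ_0)
  have c2: "rotZ x ** (U ** D ** W) ** rotZ (- x) = smul (\<epsilon> * \<eta>) (std_branch s t \<alpha> \<beta> \<gamma> \<beta>')"
  proof -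
    have "rotZ x ** (U ** D ** W) ** rotZ (- x) =
        rotZ x ** U ** (D ** rotZ z) ** transpose (rotY \<beta>') ** (rotZ x ** rotZ (- x))"
      unfolding W by (simp add: matrix_mul_assoc)
    also have "\<dots> = (rotZ x ** U ** rotZ z) ** D ** transpose (rotY \<beta>')"
      unfolding D_def rotZ_diag_commute[symmetric] rotZ_add by (simp add: rotZ_0 matrix_mul_assoc)
    also have "\<dots> = smul (\<epsilon> * \<eta>) (std_branch s t \<alpha> \<beta> \<gamma> \<beta>')"
      unfolding b(3) al(3) ga(3) smul_mult smul_smul D_def std_branch_def by (simp add: mult.commute)
    finally show ?thesis .
  qed
  have LU2: "LU_equivalent (of_branches D (U ** D ** W)) (of_branches D (smul (\<epsilon> * \<eta>) (std_branch s t \<alpha> \<beta> \<gamma> \<beta>')))"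
    using LU_qubits_23[of "rotZ x" "rotZ (- x)" D "U ** D ** W"] special_rotZ
    unfolding c1 c2 special_def by blast
  have "(\<epsilon> * \<eta>) * (\<epsilon> * \<eta>) = 1" "cmod (\<epsilon> * \<eta>) = 1"
    using al(2) ga(2) by auto
  then have LU3: "LU_equivalent (of_branches D (smul (\<epsilon> * \<eta>) (std_branch s t \<alpha> \<beta> \<gamma> \<beta>'))) (of_branches D (std_branch s t \<alpha> \<beta> \<gamma> \<beta>'))"
    using mixed_LU[OF mixed_phases[of 1 "\<epsilon> * \<eta>" D "smul (\<epsilon> * \<eta>) (std_branch s t \<alpha> \<beta> \<gamma> \<beta>')"]]
    by (simp add: smul_smul)
  \<comment> \<open>Each branch has squared norm 1/2, so the normalized Schmidt coefficients are
    \<open>sqrt 2\<close> times the singular values.\<close>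
  have "sqrt 2 * s * (sqrt 2 * t) = (sqrt 2 * sqrt 2) * (s * t)" by (simp only: ac_simps)
  then have ab: "sqrt 2 * s * (sqrt 2 * t) = c" using 1(7) by simp
  have eq: "1 / sqrt 2 * (sqrt 2 * s) = s" "1 / sqrt 2 * (sqrt 2 * t) = t" by simp_all
  have "is_decomposition (of_branches M N) (sqrt 2 * s) (sqrt 2 * t) \<alpha> \<beta> \<gamma> \<beta>'"
    unfolding is_decomposition_def std_state_eq smul_diag smul_std_branch eq
    using 1(3,4,6) al ga b b' LU_trans[OF LU_trans[OF LU1 LU2] LU3]
    by (simp add: power_mult_distrib D_def)
  with ab show ?thesis by blast
qed

lemma cnj_mat_mult: "cnj_mat (M ** N) = cnj_mat M ** cnj_mat N"
  by (simp add: cnj_mat_def map_matrix_def vec_eq_iff matrix_matrix_mult_def)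

lemma cnj_std_branch: "cnj_mat (std_branch a b \<alpha> \<beta> \<gamma> \<beta>') = std_branch a b (- \<alpha>) \<beta> (- \<gamma>) \<beta>'"
  unfolding std_branch_def cnj_mat_mult by (simp add: rotZ_eq rotY_eq cis_cnj)

text \<open>Conjugation by \<open>rotZ \<theta>\<close> fixes the diagonal branch and moves \<theta>
  from \<gamma> to \<alpha>. It needs the right factor \<open>rotY \<beta>'\<close> to be
  absent.\<close>

lemma LU_std_shift:
  "LU_equivalent (of_branches (mat2 (of_real a) 0 0 (of_real b)) (rotZ \<alpha> ** rotY \<beta> ** rotZ \<gamma> ** mat2 (of_real a) 0 0 (of_real b)))
    (of_branches (mat2 (of_real a) 0 0 (of_real b)) (rotZ (\<alpha> + \<theta>) ** rotY \<beta> ** rotZ (\<gamma> - \<theta>) ** mat2 (of_real a) 0 0 (of_real b)))"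
proof -
  define D where "D = mat2 (of_real a) 0 0 (of_real b)"
  have c1: "rotZ \<theta> ** D ** rotZ (- \<theta>) = D"
    unfolding D_def rotZ_diag_commute matrix_mul_assoc[symmetric] rotZ_add by (simp add: rotZ_0)
  have "rotZ \<theta> ** (rotZ \<alpha> ** rotY \<beta> ** rotZ \<gamma> ** D) ** rotZ (- \<theta>) =
     (rotZ \<theta> ** rotZ \<alpha>) ** rotY \<beta> ** rotZ \<gamma> ** (D ** rotZ (- \<theta>))"
    by (simp add: matrix_mul_assoc)
  also have "\<dots> = rotZ (\<alpha> + \<theta>) ** rotY \<beta> ** (rotZ \<gamma> ** rotZ (- \<theta>)) ** D"
    unfolding D_def rotZ_diag_commute[symmetric] rotZ_add[of \<theta>] matrix_mul_assoc by (simp add: add.commute)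
  also have "\<dots> = rotZ (\<alpha> + \<theta>) ** rotY \<beta> ** rotZ (\<gamma> - \<theta>) ** D"
    using rotZ_add[of \<gamma> "- \<theta>"] by (simp add: matrix_mul_assoc[symmetric])
  finally show ?thesis
    using LU_qubits_23[of "rotZ \<theta>" "rotZ (- \<theta>)" D "rotZ \<alpha> ** rotY \<beta> ** rotZ \<gamma> ** D"] special_rotZ c1
    by (simp add: special_def D_def)
qed

text \<open>Undoing the local unitary of the second branch and exchanging the branches inverts it.\<close>

lemma LU_std_inverse:
  "LU_equivalent (of_branches (mat2 (of_real a) 0 0 (of_real b)) (std_branch a b \<alpha> \<beta> \<gamma> \<beta>'))
    (of_branches (mat2 (of_real a) 0 0 (of_real b)) (std_branch a b (- \<gamma>) \<beta> (- \<alpha>) \<beta>'))"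
proof -
  define D where "D = mat2 (of_real a) 0 0 (of_real b)"
  \<comment> \<open>Conjugation by this matrix fixes diagonal matrices and inverts
    \<open>rotY\<close>, which undoes the sign changes of \<beta> and \<beta>' caused by the
    adjoints.\<close>
  define S where "S = mat2 1 0 0 (-1)"
  define U where "U = rotZ \<alpha> ** rotY \<beta> ** rotZ \<gamma>"
  define W where "W = transpose (rotY \<beta>')"
  have SS: "S ** S = mat 1" and SD: "S ** D ** S = D" and uS: "unitary S"
    by (simp_all add: S_def D_def mat_1_mat2 unitary_mat2_iff)
  have sU: "special U" unfolding U_def by (intro special_mult special_rotZ special_rotY)
  have sW: "special W" unfolding W_def by (intro special_transpose special_rotY)
  have "(S ** dagger U) ** D ** (dagger W ** S) = S ** dagger U ** (S ** S) ** D ** (S ** S) ** dagger W ** S"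
    unfolding SS by (simp add: matrix_mul_assoc)
  also have "\<dots> = (S ** dagger U ** S) ** (S ** D ** S) ** (S ** dagger W ** S)"
    by (simp only: matrix_mul_assoc)
  also have "S ** dagger U ** S = rotZ (- \<gamma>) ** rotY \<beta> ** rotZ (- \<alpha>)"
    unfolding S_def U_def dagger_mult rotZ_eq rotY_eq by (simp add: cis_cnj)
  also have "S ** dagger W ** S = W"
    unfolding S_def W_def rotY_eq by simp
  finally have 1: "(S ** dagger U) ** D ** (dagger W ** S) = std_branch a b (- \<gamma>) \<beta> (- \<alpha>) \<beta>'"
    unfolding SD std_branch_def by (simp add: D_def W_def)
  have "(S ** dagger U) ** (U ** D ** W) ** (dagger W ** S) = S ** (dagger U ** U) ** D ** (W ** dagger W) ** S"
    by (simp add: matrix_mul_assoc)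
  also have "\<dots> = D" using sU sW SD by (simp add: special_def unitary_def)
  finally have 2: "(S ** dagger U) ** (U ** D ** W) ** (dagger W ** S) = D" .
  have "unitary (S ** dagger U)" "unitary (dagger W ** S)"
    using sU sW uS by (auto simp: special_def intro!: unitary_mult unitary_dagger)
  from LU_qubits_23[OF this, of D "U ** D ** W"]
  have "LU_equivalent (of_branches D (U ** D ** W)) (of_branches (std_branch a b (- \<gamma>) \<beta> (- \<alpha>) \<beta>') D)"
    unfolding 1 2 .
  moreover have "U ** D ** W = std_branch a b \<alpha> \<beta> \<gamma> \<beta>'"
    by (simp add: std_branch_def U_def D_def W_def)
  ultimately show ?thesis
    using LU_trans mixed_LU[OF mixed_swap] unfolding D_def by metis
qed

text \<open>Conjugation of the state replaces the angles \<alpha>, \<gamma> by -\<alpha>, -\<gamma>,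
  while \<open>LU_std_inverse\<close> reaches -\<gamma>, -\<alpha>. Equal angles make these agree;
  the other conditions each offer a way to exchange or remove the angles.\<close>

lemma LU_cnj_std:
  assumes "b = 0 \<or> a = b \<or> sin \<beta> = 0 \<or> sin \<beta>' = 0 \<or> \<alpha> = \<gamma>"
  defines "\<xi> \<equiv> of_branches (mat2 (of_real a) 0 0 (of_real b)) (std_branch a b \<alpha> \<beta> \<gamma> \<beta>')"
  shows "LU_equivalent \<xi> (cnj_vec \<xi>)"
proof -
  define D where "D = mat2 (of_real a) 0 0 (of_real b)"
  have cnj: "cnj_vec \<xi> = of_branches D (std_branch a b (- \<alpha>) \<beta> (- \<gamma>) \<beta>')"
    unfolding \<xi>_def cnj_vec_of_branches cnj_std_branch by (simp add: D_def)
  note inverse = LU_std_inverse[of a b \<alpha> \<beta> \<gamma> \<beta>', folded \<xi>_def D_def]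
  consider "b = 0" | "a = b" | "sin \<beta> = 0" | "sin \<beta>' = 0" | "\<alpha> = \<gamma>"
    using assms by blast
  then show ?thesis
  proof cases
    case 1
    \<comment> \<open>For \<open>b = 0\<close> a \<open>rotZ\<close> next to the diagonal matrix is
      a scalar. A rotation of qubit 2 thus changes \<alpha> to -\<alpha> and otherwise produces only
      phases, which qubit 1 removes.\<close>
    have p: "rotZ z ** mat2 (of_real a) 0 0 (of_real b) = smul (cis z) (mat2 (of_real a) 0 0 (of_real b))" for z
      by (simp add: rotZ_eq 1)
    have "LU_equivalent \<xi> (of_branches (rotZ (- 2 * \<alpha>) ** D) (rotZ (- 2 * \<alpha>) ** std_branch a b \<alpha> \<beta> \<gamma> \<beta>'))"
      using LU_qubits_23[OF _ unitary_1, of "rotZ (- 2 * \<alpha>)" D "std_branch a b \<alpha> \<beta> \<gamma> \<beta>'"] special_rotZ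
      by (simp add: special_def \<xi>_def D_def)
    also have "rotZ (- 2 * \<alpha>) ** D = smul (cis (- 2 * \<alpha>)) D"
      using p by (simp add: D_def)
    also have "rotZ (- 2 * \<alpha>) ** std_branch a b \<alpha> \<beta> \<gamma> \<beta>' = smul (cis (2 * \<gamma>)) (std_branch a b (- \<alpha>) \<beta> (- \<gamma>) \<beta>')"
    proof -
      have "rotZ (- 2 * \<alpha>) ** std_branch a b \<alpha> \<beta> \<gamma> \<beta>' = (rotZ (- 2 * \<alpha>) ** rotZ \<alpha>) ** rotY \<beta> ** (rotZ \<gamma> ** D) ** transpose (rotY \<beta>')"
        unfolding std_branch_def D_def by (simp add: matrix_mul_assoc)
      also have "\<dots> = smul (cis \<gamma>) (rotZ (- \<alpha>) ** rotY \<beta> ** D ** transpose (rotY \<beta>'))"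
        unfolding rotZ_add D_def p smul_mult by simp
      also have "\<dots> = smul (cis (2 * \<gamma>)) (smul (cis (- \<gamma>)) (rotZ (- \<alpha>) ** rotY \<beta> ** D ** transpose (rotY \<beta>')))"
        by (simp add: smul_smul cis_mult)
      also have "smul (cis (- \<gamma>)) (rotZ (- \<alpha>) ** rotY \<beta> ** D ** transpose (rotY \<beta>')) =
          rotZ (- \<alpha>) ** rotY \<beta> ** (rotZ (- \<gamma>) ** D) ** transpose (rotY \<beta>')"
        unfolding D_def p smul_mult ..
      also have "\<dots> = std_branch a b (- \<alpha>) \<beta> (- \<gamma>) \<beta>'"
        unfolding std_branch_def D_def by (simp add: matrix_mul_assoc)
      finally show ?thesis .
    qed
    finally show ?thesis
      using LU_trans[OF _ mixed_LU[OF mixed_phases[of "cis (2 * \<alpha>)" "cis (- 2 * \<gamma>)" "smul (cis (- 2 * \<alpha>)) D" "smul (cis (2 * \<gamma>)) (std_branch a b (- \<alpha>) \<beta> (- \<gamma>) \<beta>')"]]]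
      by (simp add: cnj smul_smul cis_mult)
  next
    case 2
    \<comment> \<open>Conjugation by \<open>J\<close> is entrywise complex conjugation on special
      unitary matrices; for \<open>a = b\<close> both branches are real multiples of such
      matrices.\<close>
    define J where "J = mat2 0 1 (-1) 0"
    have J: "unitary J" by (simp add: J_def unitary_mat2_iff)
    define W where "W = rotZ \<alpha> ** rotY \<beta> ** rotZ \<gamma> ** transpose (rotY \<beta>')"
    have "special W"
      unfolding W_def by (intro special_mult special_rotZ special_rotY special_transpose)
    then obtain p q where pq: "W = mat2 p q (- cnj q) (cnj p)" by (rule special_cases)
    have D: "D = smul (of_real a) (mat 1)" by (simp add: D_def 2 mat_1_mat2)
    have N: "std_branch a b \<alpha> \<beta> \<gamma> \<beta>' = smul (of_real a) W"
      unfolding std_branch_def D_def[symmetric] D smul_mult W_def by simp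
    have "J ** D ** dagger J = D"
      by (simp add: D J_def mat_1_mat2)
    moreover have "J ** std_branch a b \<alpha> \<beta> \<gamma> \<beta>' ** dagger J = cnj_mat (std_branch a b \<alpha> \<beta> \<gamma> \<beta>')"
      unfolding N by (simp add: pq J_def)
    ultimately show ?thesis
      using LU_qubits_23[OF J unitary_dagger[OF J], of D "std_branch a b \<alpha> \<beta> \<gamma> \<beta>'"]
      unfolding cnj by (simp add: \<xi>_def D_def cnj_std_branch)
  next
    case 3
    \<comment> \<open>Here \<open>rotY \<beta>\<close> is diagonal, so only the sum of \<alpha> and
      \<gamma> enters.\<close>
    have "std_branch a b (- \<gamma>) \<beta> (- \<alpha>) \<beta>' = std_branch a b (- \<alpha>) \<beta> (- \<gamma>) \<beta>'"
      unfolding std_branch_def rotY_eq[of \<beta>] rotZ_eq using 3 by (simp add: mult.commute mult.left_commute)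
    then show ?thesis using inverse cnj by simp
  next
    case 4
    then have "cos \<beta>' = 1 \<or> cos \<beta>' = - 1"
      using sin_cos_squared_add[of \<beta>'] by (simp add: power2_eq_1_iff)
    \<comment> \<open>The right factor is a sign, so \<open>LU_std_shift\<close> becomes available
      to exchange the two angles.\<close>
    then obtain k where k: "transpose (rotY \<beta>') = smul k (mat 1)" "k = 1 \<or> k = - 1"
      using 4 by (auto simp: rotY_eq mat_1_mat2)
    have N: "std_branch a b x \<beta> z \<beta>' = smul k (rotZ x ** rotY \<beta> ** rotZ z ** D)" for x z
      unfolding std_branch_def D_def k smul_mult by simp
    have sgn: "LU_equivalent (of_branches K L) (of_branches K (smul k L))" for K L
      using mixed_LU[OF mixed_phases[of 1 k K L]] k(2) by auto
    have sgn': "LU_equivalent (of_branches K (smul k L)) (of_branches K L)" for K L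
      using sgn LU_sym by blast
    have "LU_equivalent (of_branches D (rotZ (- \<gamma>) ** rotY \<beta> ** rotZ (- \<alpha>) ** D))
       (of_branches D (rotZ (- \<alpha>) ** rotY \<beta> ** rotZ (- \<gamma>) ** D))"
      using LU_std_shift[of a b "- \<gamma>" \<beta> "- \<alpha>" "\<gamma> - \<alpha>"] by (simp add: D_def)
    then have "LU_equivalent (of_branches D (smul k (rotZ (- \<gamma>) ** rotY \<beta> ** rotZ (- \<alpha>) ** D)))
       (of_branches D (smul k (rotZ (- \<alpha>) ** rotY \<beta> ** rotZ (- \<gamma>) ** D)))"
      by (rule LU_trans[OF LU_trans[OF sgn'] sgn])
    then show ?thesis
      using LU_trans[OF inverse] unfolding cnj N by blast
  next
    case 5
    then show ?thesis using inverse cnj by simp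
  qed
qed

text \<open>The factors of this product account for all the alternatives in
  \<open>LU_cnj_std\<close> except \<open>b = 0\<close>.\<close>

lemma Im_pdet_std:
  "Im (pdet (mat2 (of_real a) 0 0 (of_real b)) (std_branch a b \<alpha> \<beta> \<gamma> \<beta>')) =
     (b\<^sup>2 - a\<^sup>2) * sin \<beta> * sin \<beta>' * sin (\<alpha> - \<gamma>)"
  unfolding std_branch_def rotY_eq rotZ_eq
  by (simp add: sin_diff power2_eq_square algebra_simps)

subsection \<open>Entropy\<close>

lemma proj_psi_s: "ptrace_snd (proj (psi_s a b)) = mat2 (of_real (a\<^sup>2)) 0 0 (of_real (b\<^sup>2))"
proof -
  have psi: "psi_s a b $ (j, k) = mat2 (of_real a) 0 0 (of_real b) $ j $ k" for j k
    by (auto simp: psi_s_def ket_def tensor_vec_def axis_def mat2_def scaleR_conv_of_real[where 'a=complex] neq_zero_iff_2)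
  show ?thesis
    by (simp add: mat_eq_iff_2 ptrace_snd_def proj_def sum_2' psi power2_eq_square)
qed

lemma charpoly_mat2_diag: "charpoly (mat2 x 0 0 y) = [:- x, 1:] * [:- y, 1:]"
  unfolding charpoly_def det_2 two_eq_zero by (simp add: algebra_simps)

text \<open>The reduced state has eigenvalues \<open>a\<^sup>2\<close> and \<open>b\<^sup>2\<close>,
  and \<open>2 * a * b\<close> is the concurrence: one minus its square is the square of
  \<open>a\<^sup>2 - b\<^sup>2\<close>.\<close>

lemma entanglement_psi_s:
  assumes "a \<ge> b" "b \<ge> 0" "a\<^sup>2 + b\<^sup>2 = 1"
  shows "entanglement (psi_s a b) = ent_of_concurrence (2 * a * b)"
proof -
  have "entanglement (psi_s a b) = - (a\<^sup>2 * log 2 (a\<^sup>2) + b\<^sup>2 * log 2 (b\<^sup>2))"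
    unfolding entanglement_def vn_entropy_def proj_psi_s charpoly_mat2_diag
    by (simp add: proots_mult del: of_real_power mult_pCons_left mult_pCons_right)
  also have "\<dots> = binary_entropy (a\<^sup>2)"
  proof -
    have "1 - a\<^sup>2 = b\<^sup>2" using assms(3) by simp
    then show ?thesis unfolding binary_entropy_def by simp
  qed
  also have "binary_entropy (a\<^sup>2) = ent_of_concurrence (2 * a * b)"
  proof -
    have "1 - (2 * a * b)\<^sup>2 = (a\<^sup>2 - b\<^sup>2)\<^sup>2"
    proof -
      have "1 - (2 * a * b)\<^sup>2 = (a\<^sup>2 + b\<^sup>2)\<^sup>2 - (2 * a * b)\<^sup>2" using assms(3) by simp
      then show ?thesis by (simp add: power2_eq_square algebra_simps)
    qed
    moreover have "b\<^sup>2 \<le> a\<^sup>2" using assms by (simp add: power_mono)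
    ultimately have "sqrt (1 - (2 * a * b)\<^sup>2) = a\<^sup>2 - b\<^sup>2" by simp
    then have "(1 + sqrt (1 - (2 * a * b)\<^sup>2)) / 2 = a\<^sup>2" using assms(3) by simp
    then show ?thesis
      unfolding ent_of_concurrence_def by simp
  qed
  finally show ?thesis .
qed

text \<open>The derivative \<open>log 2 (1 - t) - log 2 t\<close> is negative beyond 1/2. The
  endpoint 1 is excluded here because of the logarithm of \<open>1 - x\<close>;
  \<open>binary_entropy_inj\<close> treats it by positivity of the entropy inside the
  interval.\<close>

lemma binary_entropy_strict_antimono:
  assumes "1 / 2 \<le> x" "x < y" "y < 1"
  shows "binary_entropy y < binary_entropy x"
proof (rule DERIV_neg_imp_decreasing_open[OF assms(2)])
  fix t assume t: "x < t" "t < y"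
  have t01: "0 < t" "t < 1" using t assms by simp_all
  have "((\<lambda>x. - (x * ln x) - (1 - x) * ln (1 - x)) has_real_derivative ln (1 - t) - ln t) (at t)"
    using t01 by (auto intro!: derivative_eq_intros)
  from DERIV_cdivide[OF this, of "ln 2"]
  have "(binary_entropy has_real_derivative log 2 (1 - t) - log 2 t) (at t)"
    unfolding binary_entropy_def[abs_def] log_def by (simp add: diff_divide_distrib)
  moreover have "log 2 (1 - t) < log 2 t" using t assms by simp
  ultimately show "\<exists>d. (binary_entropy has_real_derivative d) (at t) \<and> d < 0"
    by (intro exI[of _ "log 2 (1 - t) - log 2 t"]) simp
next
  show "continuous_on {x..y} binary_entropy"
    unfolding binary_entropy_def[abs_def] log_def using assms
    by (intro continuous_intros) auto
qed

lemma binary_entropy_pos: "0 < x \<Longrightarrow> x < 1 \<Longrightarrow> 0 < binary_entropy x"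
proof -
  assume x: "0 < x" "x < 1"
  then have "x * log 2 x < 0" "(1 - x) * log 2 (1 - x) < 0"
    by (simp_all add: mult_pos_neg)
  then show ?thesis unfolding binary_entropy_def by simp
qed

lemma binary_entropy_inj:
  assumes "1 / 2 \<le> x" "x \<le> 1" "1 / 2 \<le> y" "y \<le> 1" "binary_entropy x = binary_entropy y"
  shows "x = y"
proof -
  have False if "1 / 2 \<le> x" "x < y" "y \<le> 1" "binary_entropy x = binary_entropy y" for x y
  proof (cases "y = 1")
    case True
    then have "binary_entropy y = 0" by (simp add: binary_entropy_def)
    then show False using binary_entropy_pos[of x] that True by simp
  next
    case False
    then show False using binary_entropy_strict_antimono[of x y] that by simp
  qed
  then show ?thesis using assms by (metis linorder_neqE)
qed

text \<open>The arguments of the binary entropy lie in [1/2, 1], where it is injective. Equations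
  between entropies thus become equations between concurrences.\<close>

lemma ent_of_concurrence_inj:
  assumes "0 \<le> x" "x \<le> 1" "0 \<le> y" "y \<le> 1" "ent_of_concurrence x = ent_of_concurrence y"
  shows "x = y"
proof -
  have *: "1 / 2 \<le> (1 + sqrt (1 - x\<^sup>2)) / 2" "(1 + sqrt (1 - x\<^sup>2)) / 2 \<le> 1" if "0 \<le> x" "x \<le> 1" for x :: real
    using that by (simp_all add: power_le_one)
  have "sqrt (1 - x\<^sup>2) = sqrt (1 - y\<^sup>2)"
    using binary_entropy_inj[OF *[of x] *[of y]] assms unfolding ent_of_concurrence_def by simp
  then have "x\<^sup>2 = y\<^sup>2" by simp
  then show ?thesis using assms by (simp add: power2_eq_iff_nonneg)
qed

subsection \<open>Concurrence of the reduced state\<close>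

definition flat :: "complex^2^2 \<Rightarrow> qubits2" where
  "flat M = (\<chi> p. M $ fst p $ snd p)"

lemma flat_cases: obtains K where "\<phi> = flat K"
proof
  show "\<phi> = flat (\<chi> j k. \<phi> $ (j, k))" by (simp add: flat_def vec_eq_iff)
qed

lemma norm_sq_vec: "(norm v)\<^sup>2 = (\<Sum>i\<in>UNIV. (cmod (v $ i))\<^sup>2)" for v :: "complex^'n"
  by (simp add: norm_vec_def L2_set_def sum_nonneg)

lemma norm_flat: "of_real ((norm (flat M))\<^sup>2) = frob M M"
  unfolding norm_sq_vec frob_self by (simp add: sum_UNIV_prod flat_def)

lemma norm_of_branches: "of_real ((norm (of_branches M N))\<^sup>2) = frob M M + frob N N"
  unfolding norm_sq_vec frob_self of_real_add[symmetric]
  by (simp add: sum_UNIV_prod of_branches_def sum_2')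

lemma concurrence_flat: "concurrence (flat M) = cmod (pdet M M)"
proof -
  have "cinner ((sigma_y \<otimes>\<^sub>m sigma_y) *v cnj_vec (flat M)) (flat M) = - pdet M M"
    by (simp add: cinner_def sum_UNIV_prod sum_2' matrix_vector_mult_def tensor_mat_def sigma_y_def
       cnj_vec_def flat_def pdet_def)
  then show ?thesis by (simp add: concurrence_def)
qed

lemma ptrace_fst_of_branches:
  "ptrace_fst (proj (of_branches M N)) = proj (flat M) + proj (flat N)"
  by (simp add: ptrace_fst_def proj_def vec_eq_iff sum_2' of_branches_def flat_def)

lemma unitary_columns_2:
  fixes V :: "complex^2^2"
  assumes "unitary V"
  shows "cnj (V $ 0 $ 0) * V $ 0 $ 0 + cnj (V $ 1 $ 0) * V $ 1 $ 0 = 1"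
    "cnj (V $ 0 $ 1) * V $ 0 $ 1 + cnj (V $ 1 $ 1) * V $ 1 $ 1 = 1"
    "cnj (V $ 0 $ 0) * V $ 0 $ 1 + cnj (V $ 1 $ 0) * V $ 1 $ 1 = 0"
    "cnj (V $ 0 $ 1) * V $ 0 $ 0 + cnj (V $ 1 $ 1) * V $ 1 $ 0 = 0"
proof -
  obtain a b c d where V: "V = mat2 a b c d" by (rule mat2_cases)
  show 1: "cnj (V $ 0 $ 0) * V $ 0 $ 0 + cnj (V $ 1 $ 0) * V $ 1 $ 0 = 1"
    "cnj (V $ 0 $ 1) * V $ 0 $ 1 + cnj (V $ 1 $ 1) * V $ 1 $ 1 = 1"
    "cnj (V $ 0 $ 0) * V $ 0 $ 1 + cnj (V $ 1 $ 0) * V $ 1 $ 1 = 0"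
    using assms by (auto simp: V unitary_mat2_iff)
  show "cnj (V $ 0 $ 1) * V $ 0 $ 0 + cnj (V $ 1 $ 1) * V $ 1 $ 0 = 0"
    using arg_cong[OF 1(3), of cnj] by (simp add: mult.commute)
qed

text \<open>Collecting terms leaves the entries of \<open>dagger V ** V\<close> as coefficients. The
  two sides are matching entries of the reduced states on qubits 2 and 3.\<close>

lemma mixed_sesquilinear:
  assumes "mixed M N M' N'"
  shows "M' $ i $ j * cnj (M' $ k $ l) + N' $ i $ j * cnj (N' $ k $ l) =
    M $ i $ j * cnj (M $ k $ l) + N $ i $ j * cnj (N $ k $ l)"
proof -
  obtain V :: "complex^2^2" where V: "unitary V" "M' = smul (V $ 0 $ 0) M + smul (V $ 0 $ 1) N" "N' = smul (V $ 1 $ 0) M + smul (V $ 1 $ 1) N"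
    using assms unfolding mixed_def by blast
  have "M' $ i $ j * cnj (M' $ k $ l) + N' $ i $ j * cnj (N' $ k $ l) =
     M $ i $ j * cnj (M $ k $ l) * (cnj (V $ 0 $ 0) * V $ 0 $ 0 + cnj (V $ 1 $ 0) * V $ 1 $ 0)
    + N $ i $ j * cnj (N $ k $ l) * (cnj (V $ 0 $ 1) * V $ 0 $ 1 + cnj (V $ 1 $ 1) * V $ 1 $ 1)
    + N $ i $ j * cnj (M $ k $ l) * (cnj (V $ 0 $ 0) * V $ 0 $ 1 + cnj (V $ 1 $ 0) * V $ 1 $ 1)
    + M $ i $ j * cnj (N $ k $ l) * (cnj (V $ 0 $ 1) * V $ 0 $ 0 + cnj (V $ 1 $ 1) * V $ 1 $ 0)"
    unfolding V by (simp add: smul_def algebra_simps)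
  then show ?thesis unfolding unitary_columns_2[OF V(1)] by simp
qed

lemma mixed_ptrace: "mixed M N M' N' \<Longrightarrow>
    ptrace_fst (proj (of_branches M' N')) = ptrace_fst (proj (of_branches M N))"
  unfolding ptrace_fst_of_branches
  by (simp add: proj_def vec_eq_iff flat_def mixed_sesquilinear)

lemma mixed_frob:
  assumes "mixed M N M' N'"
  shows "frob M' M' + frob N' N' = frob M M + frob N N"
proof -
  have *: "frob M M + frob N N = (M $ 0 $ 0 * cnj (M $ 0 $ 0) + N $ 0 $ 0 * cnj (N $ 0 $ 0))
    + (M $ 0 $ 1 * cnj (M $ 0 $ 1) + N $ 0 $ 1 * cnj (N $ 0 $ 1))
    + (M $ 1 $ 0 * cnj (M $ 1 $ 0) + N $ 1 $ 0 * cnj (N $ 1 $ 0))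
    + (M $ 1 $ 1 * cnj (M $ 1 $ 1) + N $ 1 $ 1 * cnj (N $ 1 $ 1))" for M N
    by (simp add: frob_def algebra_simps)
  show ?thesis unfolding * mixed_sesquilinear[OF assms] ..
qed

lemma mixed_sym: "mixed M N M' N' \<Longrightarrow> mixed M' N' M N"
proof -
  assume "mixed M N M' N'"
  then obtain V :: "complex^2^2" where V: "unitary V" "M' = smul (V $ 0 $ 0) M + smul (V $ 0 $ 1) N" "N' = smul (V $ 1 $ 0) M + smul (V $ 1 $ 1) N"
    unfolding mixed_def by blast
  have d: "dagger V $ i $ j = cnj (V $ j $ i)" for i j
    by (simp add: dagger_def map_matrix_def transpose_def)
  have comb: "smul a (smul p M + smul q N) + smul b (smul r M + smul s N) =
     smul (a * p + b * r) M + smul (a * q + b * s) N" for a b p q r s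
    by (simp add: smul_def vec_eq_iff algebra_simps)
  have "M = smul (dagger V $ 0 $ 0) M' + smul (dagger V $ 0 $ 1) N'"
    "N = smul (dagger V $ 1 $ 0) M' + smul (dagger V $ 1 $ 1) N'"
    unfolding V(2,3) d comb unitary_columns_2[OF V(1)] by simp_all
  then show ?thesis unfolding mixed_def using unitary_dagger[OF V(1)] by blast
qed

lemma frob_self_eq_0_iff: "frob M M = 0 \<longleftrightarrow> M = 0"
proof -
  have "frob M M = 0 \<longleftrightarrow> norm (flat M) = 0"
    unfolding norm_flat[symmetric] by simp
  also have "\<dots> \<longleftrightarrow> M = 0" by (auto simp: flat_def vec_eq_iff)
  finally show ?thesis .
qed

text \<open>Splits an unnormalized vector into a weight and a state. The zero matrix receives weight
  0 and an arbitrary state, since ensembles demand normalized members even at weight 0.\<close>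

lemma pure_component:
  "\<exists>p \<phi>. 0 \<le> p \<and> is_state \<phi> \<and> of_real p = frob P P \<and> p *\<^sub>R proj \<phi> = proj (flat P) \<and>
     p * concurrence \<phi> = cmod (pdet P P)"
proof (cases "P = 0")
  case True
  have "norm (ket 0 \<otimes>\<^sub>v ket 0) = 1"
  proof -
    have "(norm (ket 0 \<otimes>\<^sub>v ket 0))\<^sup>2 = 1"
      by (simp add: norm_sq_vec sum_UNIV_prod sum_2' tensor_vec_def ket_def axis_def)
    then show ?thesis by (simp add: power2_eq_1_iff) (metis norm_ge_zero not_one_le_zero neg_0_le_iff_le)
  qed
  then show ?thesis
    by (intro exI[of _ 0] exI[of _ "ket 0 \<otimes>\<^sub>v ket 0"])
       (simp add: True is_state_def frob_def pdet_def proj_def flat_def vec_eq_iff)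
next
  case False
  define n where "n = norm (flat P)"
  have n: "n > 0" using False by (auto simp: n_def flat_def vec_eq_iff)
  have n2: "of_real (n\<^sup>2) = frob P P" unfolding n_def by (rule norm_flat)
  define Q where "Q = smul (of_real (1 / n)) P"
  have Q: "flat Q = (1 / n) *\<^sub>R flat P"
    by (simp add: Q_def flat_def smul_def vec_eq_iff scaleR_conv_of_real[where 'a=complex])
  have "is_state (flat Q)"
    unfolding is_state_def Q using n by (simp add: n_def)
  moreover have "n\<^sup>2 *\<^sub>R proj (flat Q) = proj (flat P)"
    unfolding Q using n by (simp add: proj_def vec_eq_iff scaleR_conv_of_real[where 'a=complex] power2_eq_square field_simps)
  moreover have "n\<^sup>2 * concurrence (flat Q) = cmod (pdet P P)"
    unfolding concurrence_flat unfolding Q_def pdet_smul using n by (simp add: norm_mult norm_divide power2_eq_square)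
  ultimately show ?thesis using n2 by (metis zero_le_power2)
qed

lemma mean_concurrence_attained:
  assumes "frob P P + frob Q Q = 1"
  shows "cmod (pdet P P) + cmod (pdet Q Q) \<in> mean_concurrences (proj (flat P) + proj (flat Q))"
proof -
  obtain p \<phi> where 1: "0 \<le> p" "is_state \<phi>" "of_real p = frob P P" "p *\<^sub>R proj \<phi> = proj (flat P)"
     "p * concurrence \<phi> = cmod (pdet P P)" using pure_component by blast
  obtain q \<eta> where 2: "0 \<le> q" "is_state \<eta>" "of_real q = frob Q Q" "q *\<^sub>R proj \<eta> = proj (flat Q)"
     "q * concurrence \<eta> = cmod (pdet Q Q)" using pure_component by blast
  have "complex_of_real (p + q) = 1" using assms 1 2 by simp
  then have pq: "p + q = 1" using of_real_eq_1_iff by blast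
  define r where "r j = (if j = 0 then p else q)" for j :: nat
  define \<xi> where "\<xi> j = (if j = 0 then \<phi> else \<eta>)" for j :: nat
  have "is_ensemble (proj (flat P) + proj (flat Q)) 2 r \<xi>"
    using 1 2 pq by (auto simp: is_ensemble_def r_def \<xi>_def numeral_2_eq_2 less_Suc_eq)
  moreover have "(\<Sum>j<2. r j * concurrence (\<xi> j)) = cmod (pdet P P) + cmod (pdet Q Q)"
    using 1 2 by (simp add: r_def \<xi>_def numeral_2_eq_2)
  ultimately show ?thesis unfolding mean_concurrences_def by force
qed

text \<open>Both sides are the value at \<open>flat F\<close> of the quadratic form of the same
  density matrix.\<close>

lemma quadratic_form_ensemble:
  fixes n :: nat
  assumes "proj (flat M) + proj (flat N) = (\<Sum>j<n. p j *\<^sub>R proj (flat (K j)))"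
  shows "(cmod (frob F M))\<^sup>2 + (cmod (frob F N))\<^sup>2 = (\<Sum>j<n. p j * (cmod (frob F (K j)))\<^sup>2)"
proof -
  define q where "q \<rho> = (\<Sum>x\<in>UNIV. \<Sum>y\<in>UNIV. cnj (flat F $ x) * \<rho> $ x $ y * flat F $ y)"
    for \<rho> :: "complex^(2 \<times> 2)^(2 \<times> 2)"
  have q_proj: "q (proj (flat L)) = of_real ((cmod (frob F L))\<^sup>2)" for L
    unfolding complex_norm_square
    by (simp add: q_def proj_def flat_def sum_UNIV_prod sum_2' frob_def algebra_simps)
  have q_add: "q (\<rho> + \<sigma>) = q \<rho> + q \<sigma>" for \<rho> \<sigma>
    by (simp add: q_def algebra_simps sum.distrib)
  have q_scale: "q (r *\<^sub>R \<rho>) = of_real r * q \<rho>" for r \<rho>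
    by (simp add: q_def sum_distrib_left scaleR_conv_of_real[where 'a=complex] mult_ac)
  have q_0: "q 0 = 0" by (simp add: q_def)
  have q_sum: "q (\<Sum>j<n. p j *\<^sub>R proj (flat (K j))) = of_real (\<Sum>j<n. p j * (cmod (frob F (K j)))\<^sup>2)" for n
    by (induction n) (simp_all add: q_0 q_add q_scale q_proj)
  have "of_real ((cmod (frob F M))\<^sup>2 + (cmod (frob F N))\<^sup>2) = complex_of_real (\<Sum>j<n. p j * (cmod (frob F (K j)))\<^sup>2)"
    using arg_cong[OF assms, of q] unfolding q_sum q_add q_proj of_real_add .
  then show ?thesis using of_real_eq_iff by blast
qed

text \<open>Cramer's rule for the Gram matrix. The last two properties say that
  \<open>smul (frob X K) M + smul (frob Y K) N\<close> is the orthogonal projection of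
  \<open>K\<close> to the span of the branches.\<close>

lemma dual_pair:
  assumes "frob M M * frob N N - frob M N * frob N M \<noteq> 0"
  obtains X Y where "frob X M = 1" "frob X N = 0" "frob Y M = 0" "frob Y N = 1"
    "\<And>K. frob M K = frob X K * frob M M + frob Y K * frob M N"
    "\<And>K. frob N K = frob X K * frob N M + frob Y K * frob N N"
proof -
  define d where "d = frob M M * frob N N - frob M N * frob N M"
  have d: "d \<noteq> 0" using assms by (simp add: d_def)
  define X where "X = smul (cnj (frob N N / d)) M + smul (cnj (- frob M N / d)) N"
  define Y where "Y = smul (cnj (- frob N M / d)) M + smul (cnj (frob M M / d)) N"
  have X: "frob X K = (frob N N * frob M K - frob M N * frob N K) / d" for K
    unfolding X_def frob_lin by (simp add: diff_divide_distrib)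
  have Y: "frob Y K = (frob M M * frob N K - frob N M * frob M K) / d" for K
    unfolding Y_def frob_lin by (simp add: diff_divide_distrib)
  show ?thesis
  proof (rule that)
    show "frob X M = 1" "frob X N = 0" "frob Y M = 0" "frob Y N = 1"
      unfolding X Y using d by (simp_all add: d_def mult.commute)
    show "frob M K = frob X K * frob M M + frob Y K * frob M N" for K
      unfolding X Y using d by (simp add: field_simps) (simp add: d_def algebra_simps)
    show "frob N K = frob X K * frob N M + frob Y K * frob N N" for K
      unfolding X Y using d by (simp add: field_simps) (simp add: d_def algebra_simps)
  qed
qed

text \<open>The states of an ensemble lie in the range of the density matrix, and their coordinates
  with respect to the two branches have second moment one.\<close>

lemma mean_concurrence_bounds:
  assumes indep: "frob M M * frob N N - frob M N * frob N M \<noteq> 0"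
    and tau: "pdet M M = of_real l1" "pdet N N = of_real l2" "pdet M N = 0" "l1 \<ge> l2" "l2 \<ge> 0"
    and c: "c \<in> mean_concurrences (proj (flat M) + proj (flat N))"
  shows "l1 - l2 \<le> c" "c \<le> l1 + l2"
proof -
  obtain n p \<phi> where c: "c = (\<Sum>j<n. p j * concurrence (\<phi> j))"
    and ens: "is_ensemble (proj (flat M) + proj (flat N)) n p \<phi>"
    using c unfolding mean_concurrences_def by blast
  have "\<forall>j. \<exists>K. \<phi> j = flat K" using flat_cases by metis
  then obtain K where K: "\<phi> j = flat (K j)" for j by metis
  have p: "0 \<le> p j" if "j < n" for j using ens that by (simp add: is_ensemble_def)
  have \<rho>: "proj (flat M) + proj (flat N) = (\<Sum>j<n. p j *\<^sub>R proj (flat (K j)))"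
    using ens by (simp add: is_ensemble_def K)
  obtain X Y where dual: "frob X M = 1" "frob X N = 0" "frob Y M = 0" "frob Y N = 1"
    and proj: "\<And>K. frob M K = frob X K * frob M M + frob Y K * frob M N"
    "\<And>K. frob N K = frob X K * frob N M + frob Y K * frob N N"
    using dual_pair[OF indep] by blast
  define x where "x j = frob X (K j)" for j
  define y where "y j = frob Y (K j)" for j
  have span: "K j = smul (x j) M + smul (y j) N" if j: "j < n" "p j \<noteq> 0" for j
  proof -
    \<comment> \<open>\<open>W\<close> is the component of \<open>K j\<close> orthogonal to both
      branches. The density matrix vanishes on it, so ensemble members of positive weight are
      orthogonal to \<open>W\<close>; hence \<open>W\<close> is orthogonal to itself.\<close>
    define W where "W = smul 1 (K j) + smul (- 1) (smul (x j) M + smul (y j) N)"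
    have frob_W: "frob F W = frob F (K j) - (x j * frob F M + y j * frob F N)" for F
      unfolding W_def frob_lin(2) by simp
    have "frob M W = 0" "frob N W = 0"
      unfolding frob_W x_def y_def using proj[of "K j"] by simp_all
    then have W: "frob W M = 0" "frob W N = 0" using frob_comm by (metis complex_cnj_zero)+
    have "(\<Sum>k<n. p k * (cmod (frob W (K k)))\<^sup>2) = 0"
      using quadratic_form_ensemble[OF \<rho>, of W] W by simp
    then have "p j * (cmod (frob W (K j)))\<^sup>2 = 0"
      using j p by (subst (asm) sum_nonneg_eq_0_iff) auto
    then have "frob W (K j) = 0" using j by simp
    then have "frob W W = 0" using W frob_W[of W] by simp
    then have "W = 0" by (simp add: frob_self_eq_0_iff)
    then have "K j $ i $ l - (x j * M $ i $ l + y j * N $ i $ l) = 0" for i l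
    proof -
      have "K j $ i $ l - (x j * M $ i $ l + y j * N $ i $ l) = W $ i $ l"
        by (simp add: W_def smul_def)
      then show ?thesis using \<open>W = 0\<close> by simp
    qed
    then show ?thesis by (simp add: smul_def vec_eq_iff)
  qed
  have "(\<Sum>j<n. p j * (cmod (x j))\<^sup>2) = 1" "(\<Sum>j<n. p j * (cmod (y j))\<^sup>2) = 1"
    using quadratic_form_ensemble[OF \<rho>, of X] quadratic_form_ensemble[OF \<rho>, of Y] dual
    by (simp_all add: x_def y_def)
  then have sums: "(\<Sum>j<n. p j * (l1 * (cmod (x j))\<^sup>2 + k * (cmod (y j))\<^sup>2)) = l1 + k" for k
    by (simp add: algebra_simps sum.distrib flip: sum_distrib_left)
  have bnd: "p j * (l1 * (cmod (x j))\<^sup>2 + (- l2) * (cmod (y j))\<^sup>2) \<le> p j * concurrence (\<phi> j) \<and>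
     p j * concurrence (\<phi> j) \<le> p j * (l1 * (cmod (x j))\<^sup>2 + l2 * (cmod (y j))\<^sup>2)" if j: "j < n" for j
  proof (cases "p j = 0")
    case False
    \<comment> \<open>Since \<tau> is diagonal on the branches, the triangle inequality and its
      reverse bound the concurrence; averaging with second moments one gives \<open>l1 - l2\<close>
      and \<open>l1 + l2\<close>.\<close>
    have "pdet (K j) (K j) = of_real l1 * (x j)\<^sup>2 + of_real l2 * (y j)\<^sup>2"
      unfolding span[OF j False] pdet_lin pdet_comm[of N M] tau by (simp add: power2_eq_square)
    moreover have n: "cmod (of_real l1 * (x j)\<^sup>2) = l1 * (cmod (x j))\<^sup>2" "cmod (of_real l2 * (y j)\<^sup>2) = l2 * (cmod (y j))\<^sup>2"
      using tau by (simp_all add: norm_mult norm_power)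
    ultimately have "cmod (pdet (K j) (K j)) \<le> l1 * (cmod (x j))\<^sup>2 + l2 * (cmod (y j))\<^sup>2"
      "l1 * (cmod (x j))\<^sup>2 - l2 * (cmod (y j))\<^sup>2 \<le> cmod (pdet (K j) (K j))"
      using norm_triangle_ineq[of "of_real l1 * (x j)\<^sup>2" "of_real l2 * (y j)\<^sup>2"]
        norm_diff_ineq[of "of_real l1 * (x j)\<^sup>2" "of_real l2 * (y j)\<^sup>2"] by simp_all
    then show ?thesis using p[OF j] unfolding K concurrence_flat by (simp add: mult_left_mono)
  qed simp
  show "l1 - l2 \<le> c" "c \<le> l1 + l2"
  proof -
    have "(\<Sum>j<n. p j * (l1 * (cmod (x j))\<^sup>2 + (- l2) * (cmod (y j))\<^sup>2)) \<le> c"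
      "c \<le> (\<Sum>j<n. p j * (l1 * (cmod (x j))\<^sup>2 + l2 * (cmod (y j))\<^sup>2))"
      unfolding c using bnd by (auto intro!: sum_mono)
    then show "l1 - l2 \<le> c" "c \<le> l1 + l2" unfolding sums by simp_all
  qed
qed

section \<open>Linear independence of the branches and the extremal mean concurrences\<close>

text \<open>If the Gram determinant vanishes, the Gram-Schmidt remainder \<open>R\<close>, formed
  without division, is orthogonal to both branches and hence to itself.\<close>

lemma independent_branches:
  assumes "\<nexists>f g K. M = smul f K \<and> N = smul g K"
  shows "frob M M * frob N N - frob M N * frob N M \<noteq> 0"
proof
  assume 0: "frob M M * frob N N - frob M N * frob N M = 0"
  define R where "R = smul (frob M M) N + smul (- frob M N) M"
  have "frob M R = 0" "frob N R = 0"
    unfolding R_def frob_lin using 0 by (simp_all add: mult.commute)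
  then have "frob R M = 0" "frob R N = 0" using frob_comm by (metis complex_cnj_zero)+
  then have "frob R R = 0"
    using frob_lin(2)[of R "frob M M" N "- frob M N" M] by (simp add: R_def)
  then have "R = 0" by (simp add: frob_self_eq_0_iff)
  have "\<exists>f g K. M = smul f K \<and> N = smul g K"
  proof (cases "M = 0")
    case True
    then have "M = smul 0 N" "N = smul 1 N" by simp_all
    then show ?thesis by blast
  next
    case False
    then have n: "frob M M \<noteq> 0" by (simp add: frob_self_eq_0_iff)
    have "N $ i $ j = frob M N / frob M M * M $ i $ j" for i j
    proof -
      have "frob M M * N $ i $ j - frob M N * M $ i $ j = R $ i $ j"
        by (simp add: R_def smul_def)
      then show ?thesis using \<open>R = 0\<close> n by (simp add: field_simps)
    qed
    then have "M = smul 1 M" "N = smul (frob M N / frob M M) M" by (simp_all add: smul_def vec_eq_iff)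
    then show ?thesis by blast
  qed
  with assms show False ..
qed

text \<open>Branches proportional to a common matrix split off qubit 1; \<open>n\<close> shifts the
  norm between the factors so that both become states.\<close>

lemma tripartite_not_product:
  assumes "is_state (of_branches M N)" "truly_tripartite_entangled (of_branches M N)"
  shows "\<nexists>f g K. M = smul f K \<and> N = smul g K"
proof
  assume "\<exists>f g K. M = smul f K \<and> N = smul g K"
  then obtain f g K where K: "M = smul f K" "N = smul g K" by blast
  define n where "n = sqrt ((cmod f)\<^sup>2 + (cmod g)\<^sup>2)"
  have n2: "n\<^sup>2 = (cmod f)\<^sup>2 + (cmod g)\<^sup>2" by (simp add: n_def)
  have "frob M M + frob N N = of_real ((norm (of_branches M N))\<^sup>2)" by (rule norm_of_branches[symmetric])
  also have "\<dots> = 1" using assms(1) by (simp add: is_state_def)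
  finally have "of_real (n\<^sup>2) * frob K K = 1"
    unfolding K frob_smul n2 of_real_add complex_norm_square by (simp add: algebra_simps)
  then have "complex_of_real (n\<^sup>2 * (norm (flat K))\<^sup>2) = 1" by (simp only: norm_flat of_real_mult)
  then have nK: "n\<^sup>2 * (norm (flat K))\<^sup>2 = 1" using of_real_eq_1_iff by blast
  then have "n \<noteq> 0" by auto
  moreover have "n \<ge> 0" by (simp add: n_def)
  ultimately have n: "n > 0" by simp
  define \<phi> :: qubit where "\<phi> = (\<chi> i. (if i = 0 then f else g) / of_real n)"
  have "(norm \<phi>)\<^sup>2 = ((cmod f)\<^sup>2 + (cmod g)\<^sup>2) / n\<^sup>2"
    unfolding norm_sq_vec \<phi>_def by (simp add: sum_2' norm_divide power_divide add_divide_distrib)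
  also have "\<dots> = 1" using n by (simp add: n2[symmetric])
  finally have \<phi>: "is_state \<phi>" unfolding is_state_def
    using norm_ge_zero[of \<phi>] by (auto simp: power2_eq_1_iff)
  have "(n * norm (flat K))\<^sup>2 = 1" using nK by (simp add: power_mult_distrib)
  moreover have "0 \<le> n * norm (flat K)" using n by simp
  ultimately have "n * norm (flat K) = 1" by (auto simp: power2_eq_1_iff)
  then have "is_state (n *\<^sub>R flat K)" using n by (simp add: is_state_def)
  moreover have "of_branches M N $ (i, j, k) = \<phi> $ i * (n *\<^sub>R flat K) $ (j, k)" for i j k
    using n by (simp add: of_branches_def K \<phi>_def smul_def flat_def scaleR_conv_of_real[where 'a=complex])
  ultimately show False using assms(2) \<phi> unfolding truly_tripartite_entangled_def by blast
qed

lemma mixed_product: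
  assumes "mixed M N M' N'" "M' = smul f K" "N' = smul g K"
  shows "\<exists>f g K. M = smul f K \<and> N = smul g K"
proof -
  obtain V :: "complex^2^2" where "M = smul (V $ 0 $ 0) M' + smul (V $ 0 $ 1) N'" "N = smul (V $ 1 $ 0) M' + smul (V $ 1 $ 1) N'"
    using mixed_sym[OF assms(1)] unfolding mixed_def by blast
  then have "M = smul (V $ 0 $ 0 * f + V $ 0 $ 1 * g) K" "N = smul (V $ 1 $ 0 * f + V $ 1 $ 1 * g) K"
    unfolding assms by (simp_all add: smul_def vec_eq_iff algebra_simps)
  then show ?thesis by blast
qed

text \<open>Concurrence is at most the squared norm, by the arithmetic-geometric inequality. As
  \<open>frob\<close> is complex-valued, the bound is phrased through the slack
  \<open>e\<close>.\<close>

lemma pdet_le_frob: "of_real (cmod (pdet M M) + e) = frob M M \<Longrightarrow> 0 \<le> e"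
proof -
  assume *: "of_real (cmod (pdet M M) + e) = frob M M"
  obtain a b c d where M: "M = mat2 a b c d" by (rule mat2_cases)
  have "frob M M = of_real ((cmod a)\<^sup>2 + (cmod b)\<^sup>2 + (cmod c)\<^sup>2 + (cmod d)\<^sup>2)"
    unfolding M by (simp only: frob_mat2 of_real_add complex_norm_square mult.commute)
  with * have "cmod (pdet M M) + e = (cmod a)\<^sup>2 + (cmod b)\<^sup>2 + (cmod c)\<^sup>2 + (cmod d)\<^sup>2"
    by (metis of_real_eq_iff)
  moreover have "cmod (pdet M M) \<le> 2 * (cmod a * cmod d) + 2 * (cmod b * cmod c)"
  proof -
    have "pdet M M = 2 * (a * d) - 2 * (b * c)" by (simp add: M)
    then show ?thesis using norm_triangle_ineq4[of "2 * (a * d)" "2 * (b * c)"] by (simp add: norm_mult)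
  qed
  moreover have "2 * (cmod a * cmod d) \<le> (cmod a)\<^sup>2 + (cmod d)\<^sup>2" "2 * (cmod b * cmod c) \<le> (cmod b)\<^sup>2 + (cmod c)\<^sup>2"
    using sum_squares_bound[of "cmod a" "cmod d"] sum_squares_bound[of "cmod b" "cmod c"] by simp_all
  ultimately show "0 \<le> e" by simp
qed

section \<open>Balanced mixtures of two branches\<close>

definition half_mix :: "complex \<Rightarrow> complex^2^2 \<Rightarrow> complex^2^2 \<Rightarrow> complex^2^2" where
  "half_mix z M N = smul (of_real (1 / sqrt 2)) M + smul (z * of_real (1 / sqrt 2)) N"

lemma half_sqrt: "complex_of_real (1 / sqrt 2) * of_real (1 / sqrt 2) = 1 / 2"
  unfolding of_real_mult[symmetric] by simp

lemma half_mix_mixed: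
  assumes "cmod z = 1"
  shows "mixed M N (half_mix z M N) (half_mix (- z) M N)"
  unfolding half_mix_def
proof (rule mixedI)
  define r where "r = complex_of_real (1 / sqrt 2)"
  have r: "r * r = 1 / 2" "cnj r = r" unfolding r_def by (rule half_sqrt) simp
  have z: "z * cnj z = 1" using assms by (rule unit_cnj)
  have zr: "cnj (z * r) * (z * r) = 1 / 2"
    using r z by (simp; algebra)
  show "cnj (of_real (1 / sqrt 2)) * of_real (1 / sqrt 2) + cnj (of_real (1 / sqrt 2)) * of_real (1 / sqrt 2) = (1::complex)"
    unfolding r_def[symmetric] r(2) unfolding r(1) by simp
  have "cnj (- z * r) * (- z * r) = cnj (z * r) * (z * r)" by simp
  with zr show "cnj (z * of_real (1 / sqrt 2)) * (z * of_real (1 / sqrt 2)) + cnj (- z * of_real (1 / sqrt 2)) * (- z * of_real (1 / sqrt 2)) = 1"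
    unfolding r_def[symmetric] by (simp only:) simp
  show "cnj (of_real (1 / sqrt 2)) * (z * of_real (1 / sqrt 2)) + cnj (of_real (1 / sqrt 2)) * (- z * of_real (1 / sqrt 2)) = 0"
    by simp
qed

text \<open>Only the square of \<open>z\<close> enters, so the mixtures for \<open>z\<close> and
  \<open>- z\<close> have equal determinants.\<close>

lemma half_mix_pdet:
  "pdet M N = 0 \<Longrightarrow> pdet (half_mix z M N) (half_mix z M N) = (pdet M M + z\<^sup>2 * pdet N N) / 2"
proof -
  define r where "r = complex_of_real (1 / sqrt 2)"
  have r: "r * (r * w) = w / 2" for w unfolding r_def mult.assoc[symmetric] half_sqrt by simp
  assume "pdet M N = 0"
  then show "pdet (half_mix z M N) (half_mix z M N) = (pdet M M + z\<^sup>2 * pdet N N) / 2"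
    unfolding half_mix_def pdet_lin pdet_comm[of N M] r_def[symmetric]
    by (simp add: mult.left_commute[of z r] mult.assoc distrib_left r power2_eq_square add_divide_distrib)
qed

text \<open>The overlap term alone sees the sign of \<open>z\<close>; the two mixtures have equal
  norms exactly when it vanishes.\<close>

lemma half_mix_frob:
  assumes "cmod z = 1"
  shows "frob (half_mix z M N) (half_mix z M N) = (frob M M + frob N N) / 2 + of_real (Re (z * frob M N))"
proof -
  define r where "r = complex_of_real (1 / sqrt 2)"
  have r: "r * r = 1 / 2" "cnj r = r" unfolding r_def by (rule half_sqrt) simp
  have "frob (half_mix z M N) (half_mix z M N) =
     (r * r) * (frob M M + (z * cnj z) * frob N N + (z * frob M N + cnj (z * frob M N)))"
    unfolding half_mix_def frob_lin r_def[symmetric] frob_comm[of N M] by (simp add: r(2) algebra_simps)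
  also have "z * frob M N + cnj (z * frob M N) = of_real (2 * Re (z * frob M N))"
    by (rule complex_add_cnj)
  finally show ?thesis unfolding r unit_cnj[OF assms] by (simp add: field_simps)
qed

text \<open>The Takagi branches themselves attain the upper bound of
  \<open>mean_concurrence_bounds\<close>, and their balanced mixtures with \<open>z = \<i>\<close>
  the lower one. The last claim adds up \<open>pdet_le_frob\<close> over the two branches.\<close>

lemma C23_eq:
  assumes state: "is_state (of_branches M N)" "truly_tripartite_entangled (of_branches M N)"
    and mix: "mixed M N M' N'"
    and tau: "pdet M' M' = of_real l1" "pdet N' N' = of_real l2" "pdet M' N' = 0" "l1 \<ge> l2" "l2 \<ge> 0"
  shows "C23 (of_branches M N) = l1 - l2" "C23a (of_branches M N) = l1 + l2" "l1 + l2 \<le> 1"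
proof -
  define \<rho> where "\<rho> = proj (flat M') + proj (flat N')"
  have \<rho>: "ptrace_fst (proj (of_branches M N)) = \<rho>"
    using mixed_ptrace[OF mix] by (simp add: \<rho>_def ptrace_fst_of_branches)
  have one: "frob M' M' + frob N' N' = 1"
    using mixed_frob[OF mix] norm_of_branches[of M N] state by (simp add: is_state_def)
  have "\<nexists>f g K. M' = smul f K \<and> N' = smul g K"
    using tripartite_not_product[OF state] mixed_product[OF mix] by blast
  note bounds = mean_concurrence_bounds[OF independent_branches[OF this] tau, folded \<rho>_def]
  have "cmod (pdet M' M') + cmod (pdet N' N') = l1 + l2"
    using tau by simp
  then have max: "l1 + l2 \<in> mean_concurrences \<rho>"
    using mean_concurrence_attained[OF one] by (simp add: \<rho>_def)
  define P where "P = half_mix \<i> M' N'"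
  define Q where "Q = half_mix (- \<i>) M' N'"
  have PQ: "mixed M' N' P Q" unfolding P_def Q_def by (rule half_mix_mixed) simp
  have "proj (flat P) + proj (flat Q) = \<rho>"
    using mixed_ptrace[OF PQ] by (simp add: \<rho>_def ptrace_fst_of_branches)
  moreover have "frob P P + frob Q Q = 1" using mixed_frob[OF PQ] one by simp
  moreover have "pdet P P = of_real ((l1 - l2) / 2)" "pdet Q Q = of_real ((l1 - l2) / 2)"
    unfolding P_def Q_def half_mix_pdet[OF tau(3)] tau by simp_all
  then have "cmod (pdet P P) + cmod (pdet Q Q) = l1 - l2"
    using tau by (simp only: norm_of_real) simp
  ultimately have min: "l1 - l2 \<in> mean_concurrences \<rho>"
    using mean_concurrence_attained[of P Q] by simp
  show "C23 (of_branches M N) = l1 - l2" unfolding C23_def \<rho>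
    using min bounds by (intro Least_equality) auto
  show "C23a (of_branches M N) = l1 + l2" unfolding C23a_def \<rho>
    using max bounds by (intro Greatest_equality) auto
  define m where "m = (norm (flat M'))\<^sup>2 - l1"
  define n where "n = (norm (flat N'))\<^sup>2 - l2"
  have mn: "complex_of_real (l1 + m) = frob M' M'" "complex_of_real (l2 + n) = frob N' N'"
    unfolding m_def n_def by (simp_all add: norm_flat flip: of_real_power)
  then have "0 \<le> m" "0 \<le> n" using pdet_le_frob[of M' m] pdet_le_frob[of N' n] tau by simp_all
  moreover have "complex_of_real ((l1 + m) + (l2 + n)) = 1"
    using one by (simp only: of_real_add[of "l1 + m"] mn)
  then have "(l1 + m) + (l2 + n) = 1" using of_real_eq_1_iff by blast
  ultimately show "l1 + l2 \<le> 1" by simp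
qed

section \<open>Invariants of local unitary equivalence\<close>

lemma LU_branches:
  assumes "LU_equivalent (of_branches M N) (of_branches M' N')"
  obtains V A B :: "complex^2^2" where "unitary V" "unitary A" "unitary B"
    "M' = smul (V $ 0 $ 0) (A ** M ** B) + smul (V $ 0 $ 1) (A ** N ** B)"
    "N' = smul (V $ 1 $ 0) (A ** M ** B) + smul (V $ 1 $ 1) (A ** N ** B)"
proof -
  obtain V A C where u: "unitary V" "unitary A" "unitary C"
    and eq: "of_branches M' N' = (V \<otimes>\<^sub>m A \<otimes>\<^sub>m C) *v of_branches M N"
    using assms unfolding LU_equivalent_def by blast
  show ?thesis
    using that[of V A "transpose C"] u unitary_transpose
      arg_cong[OF eq[unfolded tensor_mat_of_branches], of "\<lambda>\<psi>. branch \<psi> 0"]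
      arg_cong[OF eq[unfolded tensor_mat_of_branches], of "\<lambda>\<psi>. branch \<psi> 1"]
    by simp
qed

definition tau_mat :: "complex^2^2 \<Rightarrow> complex^2^2 \<Rightarrow> complex^2^2" where
  "tau_mat M N = mat2 (pdet M M) (pdet M N) (pdet N M) (pdet N N)"

text \<open>Up to a phase the matrix of \<tau> changes by congruence with a unitary. On Takagi
  branches the invariants are \<open>l1\<^sup>2 + l2\<^sup>2\<close> and
  \<open>l1 * l2\<close>.\<close>

lemma LU_tau_mat:
  assumes "LU_equivalent (of_branches M N) (of_branches M' N')"
  shows "frob (tau_mat M' N') (tau_mat M' N') = frob (tau_mat M N) (tau_mat M N)"
    "cmod (det (tau_mat M' N')) = cmod (det (tau_mat M N))"
proof -
  obtain V A B :: "complex^2^2" where u: "unitary V" "unitary A" "unitary B"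
    and M': "M' = smul (V $ 0 $ 0) (A ** M ** B) + smul (V $ 0 $ 1) (A ** N ** B)"
    and N': "N' = smul (V $ 1 $ 0) (A ** M ** B) + smul (V $ 1 $ 1) (A ** N ** B)"
    by (rule LU_branches[OF assms])
  define d where "d = det A * det B"
  have unit: "cmod (det U) = 1" if "unitary U" for U :: "complex^2^2"
    using unitary_det[OF that] by (simp add: unit_iff)
  have d: "cmod d = 1" using u unit by (simp add: d_def norm_mult)
  have eq: "tau_mat M' N' = smul d (V ** tau_mat M N ** transpose V)"
    unfolding tau_mat_def M' N' pdet_lin pdet_two_sided d_def[symmetric] pdet_comm[of N M]
    by (rule mat2_cases[of V]) (simp add: algebra_simps)
  show "frob (tau_mat M' N') (tau_mat M' N') = frob (tau_mat M N) (tau_mat M N)"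
    unfolding eq frob_smul unit_cnj[OF d] using frob_two_sided u(1) unitary_transpose by simp
  have "det (tau_mat M' N') = d * d * (det V * det V * det (tau_mat M N))"
    unfolding eq by (rule mat2_cases[of V], rule mat2_cases[of "tau_mat M N"]) (simp add: algebra_simps)
  then show "cmod (det (tau_mat M' N')) = cmod (det (tau_mat M N))"
    using d unit[OF u(1)] by (simp add: norm_mult)
qed

text \<open>Here \<open>k\<close> is the square of \<open>z\<close>: \<open>z = 1\<close> aims at
  the maximum and \<open>z = \<i>\<close> at the minimum. The overlap condition equalizes the norms
  of the balanced mixtures, so \<open>decomposition_exists\<close> applies.\<close>

lemma decomposition_of_mixed:
  assumes mix: "mixed M N M' N'" and norm: "frob M' M' + frob N' N' = 1"
    and tau: "pdet M' M' = of_real l1" "pdet N' N' = of_real l2" "pdet M' N' = 0"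
    and z: "z = 1 \<and> k = 1 \<or> z = \<i> \<and> k = - 1" "Re (z * frob M' N') = 0" "0 \<le> l1 + k * l2"
  shows "\<exists>a b \<alpha> \<beta> \<gamma> \<beta>'. is_decomposition (of_branches M N) a b \<alpha> \<beta> \<gamma> \<beta>' \<and> 2 * a * b = l1 + k * l2"
proof -
  have z1: "cmod z = 1" "cmod (- z) = 1" "z\<^sup>2 = of_real k" using z by auto
  define P where "P = half_mix z M' N'"
  define Q where "Q = half_mix (- z) M' N'"
  have "mixed M N P Q"
    unfolding P_def Q_def using mixed_trans[OF mix half_mix_mixed[OF z1(1)]] .
  then have LU: "LU_equivalent (of_branches M N) (of_branches P Q)" by (rule mixed_LU)
  have "pdet P P = of_real ((l1 + k * l2) / 2)" "pdet Q Q = of_real ((l1 + k * l2) / 2)"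
    unfolding P_def Q_def half_mix_pdet[OF tau(3)] tau by (simp_all add: z1)
  moreover have "frob P P = 1 / 2" "frob Q Q = 1 / 2"
    unfolding P_def Q_def half_mix_frob[OF z1(1)] half_mix_frob[OF z1(2)] norm using z(2) by simp_all
  ultimately obtain a b \<alpha> \<beta> \<gamma> \<beta>' where "is_decomposition (of_branches P Q) a b \<alpha> \<beta> \<gamma> \<beta>'" "a * b = (l1 + k * l2) / 2"
    using decomposition_exists[of P Q "(l1 + k * l2) / 2"] z(3) by auto
  then have "is_decomposition (of_branches M N) a b \<alpha> \<beta> \<gamma> \<beta>'" "2 * a * b = l1 + k * l2"
    using LU_trans[OF LU] unfolding is_decomposition_def by auto
  then show ?thesis by blast
qed

text \<open>For distinct nonzero Takagi values, the unitary on the first qubit that carries the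
  state to its conjugate is diagonal, and its two phases differ by a sign.\<close>

lemma CLU_overlap_real_or_imaginary:
  assumes "LU_equivalent (of_branches M N) (cnj_vec (of_branches M N))"
    and tau: "pdet M M = of_real l1" "pdet N N = of_real l2" "pdet M N = 0" "l1 > l2" "l2 > 0"
  shows "Re (frob M N) = 0 \<or> Im (frob M N) = 0"
proof -
  obtain V A B :: "complex^2^2" where u: "unitary V" "unitary A" "unitary B"
    and M: "cnj_mat M = smul (V $ 0 $ 0) (A ** M ** B) + smul (V $ 0 $ 1) (A ** N ** B)"
    and N: "cnj_mat N = smul (V $ 1 $ 0) (A ** M ** B) + smul (V $ 1 $ 1) (A ** N ** B)"
    using assms(1) unfolding cnj_vec_of_branches by (rule LU_branches)
  define d where "d = det A * det B"
  obtain p q r s where V: "V = mat2 p q r s" by (rule mat2_cases)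
  have V1: "cnj p * p + cnj r * r = 1" "cnj q * q + cnj s * s = 1" "cnj p * q + cnj r * s = 0"
    using u(1) by (auto simp: V unitary_mat2_iff)
  have V2: "cnj q * p + cnj s * r = 0" using arg_cong[OF V1(3), of cnj] by (simp add: mult.commute)
  have MN: "pdet N M = 0" using tau(3) pdet_comm by metis
  have 00: "of_real l1 = d * (p * p * of_real l1 + q * q * of_real l2)"
    using cnj_mat_pdet[of M M] unfolding M pdet_lin pdet_two_sided d_def[symmetric] tau MN
    by (simp add: V algebra_simps)
  have 01: "0 = d * (p * r * of_real l1 + q * s * of_real l2)"
    using cnj_mat_pdet[of M N] unfolding M N pdet_lin pdet_two_sided d_def[symmetric] tau MN
    by (simp add: V algebra_simps)
  have 11: "of_real l2 = d * (r * r * of_real l1 + s * s * of_real l2)"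
    using cnj_mat_pdet[of N N] unfolding N pdet_lin pdet_two_sided d_def[symmetric] tau MN
    by (simp add: V algebra_simps)
  have d1: "cmod d = 1"
    using unitary_det[OF u(2)] unitary_det[OF u(3)] by (simp add: d_def unit_iff norm_mult)
  \<comment> \<open>With T the diagonal matrix of \<open>l1\<close>, \<open>l2\<close>, the
    equations above read T = d V T V^T. Multiplying by the entrywise conjugate of V from the right
    gives T cnj(V) = d V T, which is now read off entry by entry.\<close>
  have p: "of_real l1 * cnj p = d * p * of_real l1"
  proof -
    have "of_real l1 * cnj p + 0 * cnj r = d * (p * p * of_real l1 + q * q * of_real l2) * cnj p + d * (p * r * of_real l1 + q * s * of_real l2) * cnj r"
      by (simp only: 00[symmetric] 01[symmetric])
    also have "\<dots> = d * (p * of_real l1 * (cnj p * p + cnj r * r) + q * of_real l2 * (cnj p * q + cnj r * s))"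
      by (simp add: algebra_simps)
    finally show ?thesis unfolding V1 by simp
  qed
  have s: "of_real l2 * cnj s = d * s * of_real l2"
  proof -
    have "0 * cnj q + of_real l2 * cnj s = d * (p * r * of_real l1 + q * s * of_real l2) * cnj q + d * (r * r * of_real l1 + s * s * of_real l2) * cnj s"
      by (simp only: 11[symmetric] 01[symmetric])
    also have "\<dots> = d * (r * of_real l1 * (cnj q * p + cnj s * r) + s * of_real l2 * (cnj q * q + cnj s * s))"
      by (simp add: algebra_simps)
    finally show ?thesis unfolding V1 V2 by simp
  qed
  have q: "of_real l1 * cnj q = d * q * of_real l2"
  proof -
    have "of_real l1 * cnj q + 0 * cnj s = d * (p * p * of_real l1 + q * q * of_real l2) * cnj q + d * (p * r * of_real l1 + q * s * of_real l2) * cnj s"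
      by (simp only: 00[symmetric] 01[symmetric])
    also have "\<dots> = d * (p * of_real l1 * (cnj q * p + cnj s * r) + q * of_real l2 * (cnj q * q + cnj s * s))"
      by (simp add: algebra_simps)
    finally show ?thesis unfolding V1 V2 by simp
  qed
  \<comment> \<open>Taking moduli forces \<open>q = 0\<close>, because the two Takagi values
    differ.\<close>
  have "l1 * cmod q = cmod q * l2"
    using arg_cong[OF q, of cmod] d1 tau by (simp add: norm_mult)
  then have q0: "q = 0" using tau by simp
  then have ss: "cnj s * s = 1" using V1 by simp
  then have "s \<noteq> 0" by auto
  then have r0: "r = 0" using V1(3) q0 by auto
  have pp: "cnj p * p = 1" using V1(1) r0 by simp
  have ps: "cnj p = d * p" "cnj s = d * s" using p s tau by (simp_all add: mult.commute)
  \<comment> \<open>The relative phase of the diagonal entries. Both satisfy the same conjugation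
    rule with factor \<open>d\<close>, so \<open>k\<close> is real and thus a sign.\<close>
  define k where "k = cnj p * s"
  have "cnj k = p * (d * s)" by (simp add: k_def ps(2))
  also have "\<dots> = (d * p) * s" by (simp only: ac_simps)
  finally have "cnj k = k" by (simp add: k_def ps(1)[symmetric])
  have "cnj k * k = (cnj p * p) * (cnj s * s)" unfolding k_def by (simp add: mult_ac)
  then have "k * k = 1" using pp ss \<open>cnj k = k\<close> by simp
  then have k: "k = 1 \<or> k = - 1" by (simp add: square_eq_1_iff)
  have "cnj (frob M N) = k * frob M N"
    using cnj_mat_frob[of M N] frob_two_sided[OF u(2,3)] unfolding M N frob_lin
    by (simp add: V q0 r0 k_def mult_ac)
  then show ?thesis using k by (auto simp: complex_eq_iff)
qed

section \<open>The two implications\<close>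

text \<open>A suitable overlap of the Takagi branches suffices, by
  \<open>decomposition_of_mixed\<close>. For \<open>l2 = 0\<close> or \<open>l1 = l2\<close> the
  Takagi basis has enough freedom to make the overlap imaginary; otherwise equivalence to the
  conjugate makes it real or imaginary.\<close>

lemma CLU_imp_decomposition:
  assumes state: "is_state (of_branches M N)"
    and CLU: "LU_equivalent (of_branches M N) (cnj_vec (of_branches M N))"
    and mix: "mixed M N M1 N1"
    and tau: "pdet M1 M1 = of_real l1" "pdet N1 N1 = of_real l2" "pdet M1 N1 = 0" "l1 \<ge> l2" "l2 \<ge> 0"
  shows "\<exists>a b \<alpha> \<beta> \<gamma> \<beta>'. is_decomposition (of_branches M N) a b \<alpha> \<beta> \<gamma> \<beta>' \<and> (2 * a * b = l1 - l2 \<or> 2 * a * b = l1 + l2)"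
proof -
  have one: "frob M' M' + frob N' N' = 1" if "mixed M N M' N'" for M' N'
    using mixed_frob[OF that] norm_of_branches[of M N] state by (simp add: is_state_def)
  have plus: ?thesis if "mixed M N M' N'" "pdet M' M' = of_real l1" "pdet N' N' = of_real l2" "pdet M' N' = 0"
    "Re (frob M' N') = 0" for M' N'
    using decomposition_of_mixed[OF that(1) one[OF that(1)] that(2-4), of 1 1] that(5) tau by fastforce
  consider "l2 = 0" | "l1 = l2" | "l1 > l2" "l2 > 0" using tau by linarith
  then show ?thesis
  proof cases
    case 1
    \<comment> \<open>As \<open>pdet N1 N1 = 0\<close>, the phase of \<open>N1\<close> is free and
      can make the overlap imaginary.\<close>
    obtain e where e: "cmod e = 1" "e * frob M1 N1 = of_real (cmod (frob M1 N1))"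
      using exists_phase by blast
    have "mixed M N (smul 1 M1) (smul (\<i> * e) N1)"
      using mixed_trans[OF mix mixed_phases[of 1 "\<i> * e"]] e(1) by (simp add: norm_mult)
    moreover have "frob (smul 1 M1) (smul (\<i> * e) N1) = \<i> * of_real (cmod (frob M1 N1))"
      unfolding frob_smul e(2)[symmetric] by simp
    ultimately show ?thesis
      using plus[of "smul 1 M1" "smul (\<i> * e) N1"] tau 1 unfolding pdet_smul by simp
  next
    case 2
    define g where "g = frob M1 N1"
    \<comment> \<open>A real rotation preserves a scalar matrix of \<tau>; it is chosen to cancel
      the real part of the overlap.\<close>
    obtain c s where cs: "c\<^sup>2 + s\<^sup>2 = 1" "Re g * (c\<^sup>2 - s\<^sup>2) + (Re (frob N1 N1) - Re (frob M1 M1)) * (c * s) = 0"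
      using exists_rotation by blast
    have cs1: "of_real c * of_real c + of_real s * of_real s = (1::complex)"
      using arg_cong[OF cs(1), of complex_of_real] by (simp add: power2_eq_square)
    define M2 where "M2 = smul (of_real c) M1 + smul (of_real s) N1"
    define N2 where "N2 = smul (- of_real s) M1 + smul (of_real c) N1"
    have "mixed M1 N1 M2 N2"
      unfolding M2_def N2_def using cs1 by (intro mixedI) (simp_all add: add.commute)
    then have mix2: "mixed M N M2 N2" using mix mixed_trans by blast
    have MN: "pdet N1 M1 = 0" using tau(3) pdet_comm by metis
    have "pdet M2 M2 = of_real l1 * (of_real c * of_real c + of_real s * of_real s)"
      "pdet N2 N2 = of_real l1 * (of_real c * of_real c + of_real s * of_real s)" "pdet M2 N2 = 0"
      unfolding M2_def N2_def pdet_lin tau MN using 2 by (simp_all add: algebra_simps)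
    moreover have "frob N1 M1 = cnj g" unfolding g_def by (rule frob_comm)
    then have "Re (frob M2 N2) = 0"
      unfolding M2_def N2_def frob_lin g_def[symmetric] using cs(2)
      by (simp add: algebra_simps power2_eq_square)
    ultimately show ?thesis using plus[OF mix2] 2 unfolding cs1 by simp
  next
    case 3
    have "LU_equivalent (of_branches M1 N1) (cnj_vec (of_branches M1 N1))"
      using LU_trans[OF LU_trans[OF LU_sym[OF mixed_LU[OF mix]] CLU] LU_cnj[OF mixed_LU[OF mix]]] .
    then have "Re (frob M1 N1) = 0 \<or> Im (frob M1 N1) = 0"
      using CLU_overlap_real_or_imaginary tau 3 by blast
    then show ?thesis
    proof
      assume "Re (frob M1 N1) = 0"
      then show ?thesis using plus[OF mix tau(1-3)] by simp
    next
      assume "Im (frob M1 N1) = 0"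
      then show ?thesis
        using decomposition_of_mixed[OF mix one[OF mix] tau(1-3), of \<i> "- 1"] tau by fastforce
    qed
  qed
qed

text \<open>Both branches have \<tau>-value \<open>x\<close> and mutual value \<open>y\<close>. The
  invariants and extremality make x^2 - |y|^2 and x^2 - y^2 equal in modulus, hence
  \<open>x = 0\<close> or \<open>y\<close> real. The prefactor 1/sqrt 2 is contained in
  \<open>a\<close> and \<open>b\<close>, which is why \<open>4 * a * b\<close> appears.\<close>

lemma extremal_imp_CLU_std:
  assumes ab: "b \<le> a" "0 \<le> b" and ang: "\<alpha> \<in> {- pi / 2<..pi / 2}" "\<gamma> \<in> {- pi / 2<..pi / 2}"
    and LU: "LU_equivalent (of_branches M N) (of_branches (mat2 (of_real a) 0 0 (of_real b)) (std_branch a b \<alpha> \<beta> \<gamma> \<beta>'))"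
    and tau: "pdet M M = of_real l1" "pdet N N = of_real l2" "pdet M N = 0" "l1 \<ge> l2" "l2 \<ge> 0"
    and ext: "4 * a * b = l1 - l2 \<or> 4 * a * b = l1 + l2"
  shows "b = 0 \<or> a = b \<or> sin \<beta> = 0 \<or> sin \<beta>' = 0 \<or> \<alpha> = \<gamma>"
proof -
  define D where "D = mat2 (of_real a) 0 0 (of_real b)"
  define S where "S = std_branch a b \<alpha> \<beta> \<gamma> \<beta>'"
  define x where "x = 2 * a * b"
  define y where "y = pdet D S"
  have DD: "pdet D D = of_real x" by (simp add: D_def x_def)
  have "det (rotZ t) = 1" "det (rotY t) = 1" for t
    using special_rotZ special_rotY by (simp_all add: special_def)
  then have "det S = of_real (a * b)"
    by (simp add: S_def std_branch_def det_mul)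
  then have SS: "pdet S S = of_real x" by (simp add: pdet_self x_def)
  have SD: "pdet S D = y" unfolding y_def by (rule pdet_comm)
  have NM: "pdet N M = 0" using tau(3) pdet_comm by metis
  have y2: "of_real ((cmod y)\<^sup>2) = y * cnj y" by (simp only: complex_norm_square)
  have "complex_of_real (2 * x\<^sup>2 + 2 * (cmod y)\<^sup>2) = of_real (l1\<^sup>2 + l2\<^sup>2)"
    using LU_tau_mat(1)[OF LU, folded D_def S_def] unfolding tau_mat_def DD SS SD y_def[symmetric] tau NM
    unfolding of_real_add of_real_mult y2 by (simp add: power2_eq_square)
  then have 1: "2 * x\<^sup>2 + 2 * (cmod y)\<^sup>2 = l1\<^sup>2 + l2\<^sup>2" using of_real_eq_iff by blast
  have 2: "cmod (of_real (x\<^sup>2) - y\<^sup>2) = l1 * l2"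
    using LU_tau_mat(2)[OF LU, folded D_def S_def] unfolding tau_mat_def DD SS SD y_def[symmetric] tau NM
    using tau(4,5) by (simp add: power2_eq_square norm_mult)
  have "4 * x\<^sup>2 = l1\<^sup>2 + l2\<^sup>2 - 2 * (l1 * l2) \<or> 4 * x\<^sup>2 = l1\<^sup>2 + l2\<^sup>2 + 2 * (l1 * l2)"
  proof -
    have "4 * x\<^sup>2 = (4 * a * b)\<^sup>2" by (simp add: x_def power2_eq_square)
    moreover have "(4 * a * b)\<^sup>2 = (l1 - l2)\<^sup>2 \<or> (4 * a * b)\<^sup>2 = (l1 + l2)\<^sup>2"
      using ext by (elim disjE) simp_all
    ultimately show ?thesis by (simp add: power2_sum power2_diff mult.assoc)
  qed
  then have "x\<^sup>2 - (cmod y)\<^sup>2 = l1 * l2 \<or> x\<^sup>2 - (cmod y)\<^sup>2 = - (l1 * l2)"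
    using 1 by linarith
  then have "(x\<^sup>2 - (cmod y)\<^sup>2)\<^sup>2 = (l1 * l2)\<^sup>2"
    by (simp only: power2_eq_iff)
  also have "\<dots> = (cmod (of_real (x\<^sup>2) - y\<^sup>2))\<^sup>2" by (simp only: 2)
  finally have "(x\<^sup>2 - ((Re y)\<^sup>2 + (Im y)\<^sup>2))\<^sup>2 = (x\<^sup>2 - (Re y)\<^sup>2 + (Im y)\<^sup>2)\<^sup>2 + (2 * Re y * Im y)\<^sup>2"
    by (simp add: cmod_power2 Re_power2 Im_power2 algebra_simps)
  then have "x\<^sup>2 * (Im y)\<^sup>2 = 0"
    by (simp add: power2_eq_square algebra_simps)
  then consider "x = 0" | "Im y = 0" by auto
  then show ?thesis
  proof cases
    case 1
    then show ?thesis using ab by (auto simp: x_def)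
  next
    case 2
    then have "(b\<^sup>2 - a\<^sup>2) * sin \<beta> * sin \<beta>' * sin (\<alpha> - \<gamma>) = 0"
      using Im_pdet_std by (simp add: y_def D_def S_def)
    then consider "b\<^sup>2 = a\<^sup>2" | "sin \<beta> = 0" | "sin \<beta>' = 0" | "sin (\<alpha> - \<gamma>) = 0" by auto
    then show ?thesis
    proof cases
      case 1
      then show ?thesis using ab by (simp add: power2_eq_iff_nonneg)
    next
      case 4
      \<comment> \<open>Half-open angle ranges exclude a difference of exactly \<pi>, so the sine
        vanishes only at 0.\<close>
      moreover have "- pi < \<alpha> - \<gamma>" "\<alpha> - \<gamma> < pi" using ang by auto
      ultimately show ?thesis using sin_eq_0_pi by fastforce
    qed auto
  qed
qed

theorem theorem1:
  fixes \<psi> :: qubits3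
  assumes "is_state \<psi>"
    and "truly_tripartite_entangled \<psi>"
  shows "\<psi> \<in> CLU \<longleftrightarrow>
    (\<exists>a b \<alpha> \<beta> \<gamma> \<beta>'. is_decomposition \<psi> a b \<alpha> \<beta> \<gamma> \<beta>' \<and>
       (entanglement (psi_s a b) = ent_of_concurrence (C23 \<psi>) \<or>
        entanglement (psi_s a b) = ent_of_concurrence (C23a \<psi>)))"
proof -
  obtain M N where \<psi>: "\<psi> = of_branches M N" using of_branches_branch by metis
  obtain M' N' l1 l2 where mix: "mixed M N M' N'"
    and tau: "pdet M' M' = of_real l1" "pdet N' N' = of_real l2" "pdet M' N' = 0" "l1 \<ge> l2" "l2 \<ge> 0"
    using takagi by blast
  note C23 = C23_eq[OF assms[unfolded \<psi>] mix tau, folded \<psi>]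
  show ?thesis
  proof
    assume "\<psi> \<in> CLU"
    then obtain a b \<alpha> \<beta> \<gamma> \<beta>' where dec: "is_decomposition \<psi> a b \<alpha> \<beta> \<gamma> \<beta>'"
      and "2 * a * b = l1 - l2 \<or> 2 * a * b = l1 + l2"
      using CLU_imp_decomposition[OF assms(1)[unfolded \<psi>] _ mix tau] unfolding CLU_def \<psi> by blast
    moreover have "entanglement (psi_s a b) = ent_of_concurrence (2 * a * b)"
      using dec entanglement_psi_s unfolding is_decomposition_def by blast
    ultimately have "entanglement (psi_s a b) = ent_of_concurrence (C23 \<psi>) \<or>
        entanglement (psi_s a b) = ent_of_concurrence (C23a \<psi>)"
      unfolding C23 by auto
    with dec show "\<exists>a b \<alpha> \<beta> \<gamma> \<beta>'. is_decomposition \<psi> a b \<alpha> \<beta> \<gamma> \<beta>' \<and>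
       (entanglement (psi_s a b) = ent_of_concurrence (C23 \<psi>) \<or>
        entanglement (psi_s a b) = ent_of_concurrence (C23a \<psi>))" by blast
  next
    assume "\<exists>a b \<alpha> \<beta> \<gamma> \<beta>'. is_decomposition \<psi> a b \<alpha> \<beta> \<gamma> \<beta>' \<and>
       (entanglement (psi_s a b) = ent_of_concurrence (C23 \<psi>) \<or>
        entanglement (psi_s a b) = ent_of_concurrence (C23a \<psi>))"
    then obtain a b \<alpha> \<beta> \<gamma> \<beta>' where dec: "is_decomposition \<psi> a b \<alpha> \<beta> \<gamma> \<beta>'"
      and ext: "entanglement (psi_s a b) = ent_of_concurrence (C23 \<psi>) \<or>
        entanglement (psi_s a b) = ent_of_concurrence (C23a \<psi>)" by blast
    have ab: "b \<le> a" "0 \<le> b" "a\<^sup>2 + b\<^sup>2 = 1"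
      and ang: "\<alpha> \<in> {- pi / 2<..pi / 2}" "\<gamma> \<in> {- pi / 2<..pi / 2}"
      using dec by (simp_all add: is_decomposition_def)
    have "0 \<le> (a - b)\<^sup>2" by simp
    then have "2 * a * b \<le> 1" using ab(3) by (simp add: power2_diff)
    \<comment> \<open>Injectivity applies because all concurrences involved lie in [0, 1]; for the
      extremal ones this is \<open>l1 + l2 \<le> 1\<close>.\<close>
    then have inj: "2 * a * b = c" if "ent_of_concurrence (2 * a * b) = ent_of_concurrence c" "0 \<le> c" "c \<le> 1" for c
      using ent_of_concurrence_inj[of "2 * a * b" c] that ab by simp
    have c: "2 * a * b = l1 - l2 \<or> 2 * a * b = l1 + l2"
      using ext inj[of "l1 - l2"] inj[of "l1 + l2"] tau(4,5) C23(3)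
      unfolding entanglement_psi_s[OF ab] C23 by auto
    define a' where "a' = 1 / sqrt 2 * a"
    define b' where "b' = 1 / sqrt 2 * b"
    have ab': "b' \<le> a'" "0 \<le> b'" using ab by (simp_all add: a'_def b'_def divide_right_mono)
    have "4 * a' * b' = 4 * (1 / sqrt 2 * (1 / sqrt 2)) * (a * b)"
      unfolding a'_def b'_def by (simp only: ac_simps)
    then have "4 * a' * b' = 2 * a * b" by simp
    from c[folded this] have ext': "4 * a' * b' = l1 - l2 \<or> 4 * a' * b' = l1 + l2" .
    define \<xi> where "\<xi> = of_branches (mat2 (of_real a') 0 0 (of_real b')) (std_branch a' b' \<alpha> \<beta> \<gamma> \<beta>')"
    have LU: "LU_equivalent \<psi> \<xi>"
      using dec unfolding is_decomposition_def std_state_eq smul_diag smul_std_branch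
      by (simp add: \<xi>_def a'_def b'_def)
    have "LU_equivalent (of_branches M' N') \<xi>"
      using LU_trans[OF LU_sym[OF mixed_LU[OF mix]]] LU \<psi> by simp
    from extremal_imp_CLU_std[OF ab' ang this[unfolded \<xi>_def] tau ext']
    have "LU_equivalent \<xi> (cnj_vec \<xi>)"
      unfolding \<xi>_def by (rule LU_cnj_std)
    \<comment> \<open>The chain runs from \<psi> to the standard form \<xi>, to its conjugate, and
      back along the conjugated equivalence.\<close>
    then have "LU_equivalent \<psi> (cnj_vec \<psi>)"
      using LU_trans[OF LU_trans[OF LU] LU_sym[OF LU_cnj[OF LU]]] by simp
    then show "\<psi> \<in> CLU" using assms(1) by (simp add: CLU_def)
  qed
qed

end
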